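(* There is an absolute constant $c'$ such that for every $n\ge c'$, no set of $n$ lines in the plane, labelled $1,\dots,n$, supports all $n$-vertex planar graphs.
   Context: A straight-line crossing-free drawing of a graph maps its vertices to distinct points of the plane and each edge to the closed segment between its endpoints, such that no edge contains a vertex other than its endpoints and no two edges intersect except at a common endpoint. A vertex labelling of an $n$-vertex graph $G=(V,E)$ is a bijection $\pi:V\to\{1,\dots,n\}$. A set of $n$ distinct lines labelled $1,\dots,n$ supports $G$ with vertex labelling $\pi$ if there is a straight-line crossing-free drawing of $G$ in which, for each $i$, the vertex $\pi^{-1}(i)$ is placed on line $i$. The labelled line set supports $G$ if it supports $G$ with every vertex labelling $\pi$ of $G$. *)

theory Defs
  imports "HOL-Analysis.Analysis"
begin

type_synonym point = "real^2"

definition is_line :: "point set \<Rightarrow> bool" where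
  "is_line S \<longleftrightarrow> (\<exists>a b. a \<noteq> 0 \<and> S = {x. a \<bullet> x = b})"

definition simple_graph :: "nat set \<Rightarrow> nat set set \<Rightarrow> bool" where
  "simple_graph V E \<longleftrightarrow> finite V \<and> (\<forall>e\<in>E. \<exists>u v. u \<in> V \<and> v \<in> V \<and> u \<noteq> v \<and> e = {u, v})"

definition straight_drawing :: "nat set \<Rightarrow> nat set set \<Rightarrow> (nat \<Rightarrow> point) \<Rightarrow> bool" where
  "straight_drawing V E p \<longleftrightarrow>
     inj_on p V \<and>
     (\<forall>e\<in>E. \<forall>u v. e = {u, v} \<longrightarrow>
        (\<forall>w\<in>V - e. p w \<notin> closed_segment (p u) (p v))) \<and>
     (\<forall>e\<in>E. \<forall>f\<in>E. \<forall>u v x y. e = {u, v} \<longrightarrow> f = {x, y} \<longrightarrow> e \<noteq> f \<longrightarrow>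
        closed_segment (p u) (p v) \<inter> closed_segment (p x) (p y) \<subseteq> p ` (e \<inter> f))"

definition planar :: "nat set \<Rightarrow> nat set set \<Rightarrow> bool" where
  "planar V E \<longleftrightarrow> (\<exists>(p :: nat \<Rightarrow> point) (\<gamma> :: nat set \<Rightarrow> real \<Rightarrow> point).
     inj_on p V \<and>
     (\<forall>e\<in>E. arc (\<gamma> e) \<and> (\<exists>u v. e = {u, v} \<and> pathstart (\<gamma> e) = p u \<and> pathfinish (\<gamma> e) = p v)) \<and>
     (\<forall>e\<in>E. \<forall>w\<in>V - e. p w \<notin> path_image (\<gamma> e)) \<and>
     (\<forall>e\<in>E. \<forall>f\<in>E. e \<noteq> f \<longrightarrow> path_image (\<gamma> e) \<inter> path_image (\<gamma> f) \<subseteq> p ` (e \<inter> f)))"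

definition supports_with :: "(nat \<Rightarrow> point set) \<Rightarrow> nat set \<Rightarrow> nat set set \<Rightarrow> (nat \<Rightarrow> nat) \<Rightarrow> bool" where
  "supports_with L V E \<pi> \<longleftrightarrow> (\<exists>p. straight_drawing V E p \<and> (\<forall>v\<in>V. p v \<in> L (\<pi> v)))"

definition supports :: "(nat \<Rightarrow> point set) \<Rightarrow> nat set \<Rightarrow> nat set set \<Rightarrow> bool" where
  "supports L V E \<longleftrightarrow> (\<forall>\<pi>. bij_betw \<pi> V {1..card V} \<longrightarrow> supports_with L V E \<pi>)"

definition labelled_lines :: "nat \<Rightarrow> (nat \<Rightarrow> point set) \<Rightarrow> bool" where
  "labelled_lines n L \<longleftrightarrow> inj_on L {1..n} \<and> (\<forall>i\<in>{1..n}. is_line (L i))"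

end

theory Submission
  imports Defs "HOL-Library.Ramsey"
begin

text \<open>
  Identify a line with the vector of coefficients of its equation in \<open>\<real>\<^sup>3\<close>. By Ramsey's theorem applied
  to the signs of the determinants of triples (and, if all of these vanish, to the orientations of
  pairs), every large set of lines contains a long sequence in which any four lines \<open>i < j < k < l\<close> satisfy
  a linear dependency with alternating signs. Hence along this sequence the sign vector of a point cannot
  alternate \<open>+ - + -\<close>, and the last sign may even be replaced by \<open>0\<close>.

  The graph is a stacked triangulation with three hubs; over each of the three sides of the hub triangle
  stands a path all of whose vertices are joined to both ends of the side. In a straight-line drawing
  four consecutive path vertices \<open>x, y, z, t\<close> on the same side of the line through the hubs \<open>u, v\<close> span nested
  triangles over \<open>u v\<close>. If the four lines carrying them do not separate \<open>u\<close> from \<open>v\<close>, the nesting determines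
  the sides of these lines on which \<open>z\<close> lies: placing \<open>x, t, y, z\<close> on four lines in sequence order yields
  the forbidden signs \<open>+ - + 0\<close> or \<open>- + - 0\<close>. Every line misses one of the three sides, and all but a bounded
  number of blocks of consecutive lines do not distinguish between their lines as seen from the hubs, so
  some block provides such a configuration.
\<close>

section \<open>Drawings and insertion of a vertex into an empty triangle\<close>

text \<open>Twice the signed area of the triangle \<open>a b c\<close>, positive for
  counterclockwise order.\<close>

definition orient :: "point \<Rightarrow> point \<Rightarrow> point \<Rightarrow> real" where
  "orient a b c = (b$1 - a$1) * (c$2 - a$2) - (b$2 - a$2) * (c$1 - a$1)"

text \<open>The interior of the triangle if its corners run counterclockwise. The three values add
  up to \<open>orient a b c\<close>, so for clockwise or collinear corners the set is empty.\<close>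

definition open_tri :: "point \<Rightarrow> point \<Rightarrow> point \<Rightarrow> point set" where
  "open_tri a b c = {q. 0 < orient a b q \<and> 0 < orient b c q \<and> 0 < orient c a q}"

text \<open>Edges enter as convex hulls of their images, so no order of the two ends has to be
  chosen or quantified over.\<close>

definition crossing_free :: "nat set \<Rightarrow> nat set set \<Rightarrow> (nat \<Rightarrow> point) \<Rightarrow> bool" where
  "crossing_free V E p \<longleftrightarrow> inj_on p V \<and>
     (\<forall>e\<in>E. \<forall>w\<in>V - e. p w \<notin> convex hull (p ` e)) \<and>
     (\<forall>e\<in>E. \<forall>f\<in>E. e \<noteq> f \<longrightarrow> convex hull (p ` e) \<inter> convex hull (p ` f) \<subseteq> p ` (e \<inter> f))"

lemma straight_drawing_iff_crossing_free:
  assumes "simple_graph V E"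
  shows "straight_drawing V E p \<longleftrightarrow> crossing_free V E p"
proof -
  have pair: "\<exists>u v. e = {u, v}" if "e \<in> E" for e
    using assms that unfolding simple_graph_def by blast
  show ?thesis
  proof
    assume d: "straight_drawing V E p"
    note d' = d[unfolded straight_drawing_def]
    have inj: "inj_on p V"
      and vert: "\<forall>e\<in>E. \<forall>u v. e = {u, v} \<longrightarrow> (\<forall>w\<in>V - e. p w \<notin> closed_segment (p u) (p v))"
      and edge: "\<forall>e\<in>E. \<forall>f\<in>E. \<forall>u v x y. e = {u, v} \<longrightarrow> f = {x, y} \<longrightarrow> e \<noteq> f \<longrightarrow>
        closed_segment (p u) (p v) \<inter> closed_segment (p x) (p y) \<subseteq> p ` (e \<inter> f)"
      using conjunct1[OF d'] conjunct1[OF conjunct2[OF d']] conjunct2[OF conjunct2[OF d']] .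
    show "crossing_free V E p"
      unfolding crossing_free_def
    proof (intro conjI ballI impI)
      show "inj_on p V" by (fact inj)
    next
      fix e w assume e: "e \<in> E" and w: "w \<in> V - e"
      obtain u v where uv: "e = {u, v}" using pair[OF e] by (elim exE)
      show "p w \<notin> convex hull (p ` e)"
        using vert[rule_format, OF e uv w]
        by (simp only: uv segment_convex_hull image_insert image_empty not_False_eq_True)
    next
      fix e f assume ef: "e \<in> E" "f \<in> E" "e \<noteq> f"
      obtain u v where e: "e = {u, v}" using pair[OF ef(1)] by (elim exE)
      obtain x y where f: "f = {x, y}" using pair[OF ef(2)] by (elim exE)
      show "convex hull (p ` e) \<inter> convex hull (p ` f) \<subseteq> p ` (e \<inter> f)"
        using edge[rule_format, OF ef(1,2) e f ef(3)]
        by (simp only: e f segment_convex_hull image_insert image_empty)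
    qed
  next
    assume c: "crossing_free V E p"
    show "straight_drawing V E p"
      unfolding straight_drawing_def
    proof (intro conjI ballI allI impI)
      show "inj_on p V" using c by (simp add: crossing_free_def)
    next
      fix e u v w assume "e \<in> E" "w \<in> V - e" and e: "e = {u, v}"
      then have "p w \<notin> convex hull (p ` e)" using c unfolding crossing_free_def by blast
      then show "p w \<notin> closed_segment (p u) (p v)" by (simp only: e segment_convex_hull image_insert image_empty not_False_eq_True)
    next
      fix e f u v x y assume ef: "e \<in> E" "f \<in> E" "e \<noteq> f" and e: "e = {u, v}" and f: "f = {x, y}"
      have "convex hull (p ` e) \<inter> convex hull (p ` f) \<subseteq> p ` (e \<inter> f)"
        using c[unfolded crossing_free_def] ef by (simp only: not_False_eq_True)
      then show "closed_segment (p u) (p v) \<inter> closed_segment (p x) (p y) \<subseteq> p ` (e \<inter> f)"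
        by (simp only: e f segment_convex_hull image_insert image_empty)
    qed
  qed
qed

lemma crossing_free_imp_planar:
  assumes G: "simple_graph V E" and "crossing_free V E p"
  shows "planar V E"
proof -
  \<comment> \<open>\<open>Min\<close> and \<open>Max\<close> single out a first and a last end, so
    that the arc can be a function of the edge alone.\<close>
  have ends: "e = {Min e, Max e} \<and> Min e \<in> V \<and> Max e \<in> V \<and> Min e \<noteq> Max e" if e: "e \<in> E" for e
  proof -
    obtain u v where "u \<in> V" "v \<in> V" "u \<noteq> v" "e = {u, v}"
      using G[unfolded simple_graph_def, THEN conjunct2, THEN bspec, OF e] by (elim exE conjE)
    then show ?thesis by (cases "u < v") (auto simp: min_def max_def)
  qed
  define \<gamma> where "\<gamma> e = linepath (p (Min e)) (p (Max e))" for e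
  have im: "path_image (\<gamma> e) = convex hull (p ` e)" if "e \<in> E" for e
  proof -
    have "p ` e = {p (Min e), p (Max e)}"
      using ends[OF that] by (metis image_empty image_insert)
    then show ?thesis by (simp only: \<gamma>_def path_image_linepath segment_convex_hull)
  qed
  have inj: "inj_on p V" using assms by (simp add: crossing_free_def)
  show ?thesis
    unfolding planar_def
  proof (intro exI[of _ p] exI[of _ \<gamma>] conjI ballI impI)
    fix e assume "e \<in> E"
    show "arc (\<gamma> e)"
      unfolding \<gamma>_def using ends[OF \<open>e \<in> E\<close>] inj by (auto intro!: arc_linepath simp: inj_on_eq_iff)
    show "\<exists>u v. e = {u, v} \<and> pathstart (\<gamma> e) = p u \<and> pathfinish (\<gamma> e) = p v"
      using ends[OF \<open>e \<in> E\<close>] by (auto simp: \<gamma>_def)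
  qed (use assms im in \<open>auto simp: crossing_free_def inj\<close>)
qed

section \<open>Orientations, open triangles and spokes\<close>

lemma orient_affine:
  "orient a b ((1 - t) *\<^sub>R u + t *\<^sub>R v) = (1 - t) * orient a b u + t * orient a b v"
  by (simp add: orient_def algebra_simps)

lemma orient_degenerate [simp]: "orient a a c = 0" "orient a b a = 0" "orient a b b = 0"
  by (simp_all add: orient_def)

lemma orient_rotate: "orient b c a = orient a b c" and orient_swap: "orient a c b = - orient a b c"
  by (simp_all add: orient_def algebra_simps)

lemma open_tri_rotate: "open_tri b c a = open_tri a b c"
  by (auto simp: open_tri_def)

lemma mem_hull_pair: "q \<in> convex hull {x, u} \<longleftrightarrow> (\<exists>t\<ge>0. t \<le> 1 \<and> q = (1 - t) *\<^sub>R x + t *\<^sub>R u)"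
  by (auto simp: segment_convex_hull[symmetric] in_segment)

text \<open>Along the segment the three functions that define the triangle are affine: positive at
  \<open>x\<close>, nonnegative at \<open>u\<close>, hence positive before \<open>u\<close>.\<close>

lemma segment_to_corner:
  assumes D: "0 < orient a b c" and x: "x \<in> open_tri a b c" and u: "u \<in> {a, b, c}"
    and q: "q \<in> convex hull {x, u}" and ne: "q \<noteq> u"
  shows "q \<in> open_tri a b c"
proof -
  obtain t where t: "0 \<le> t" "t \<le> 1" "q = (1 - t) *\<^sub>R x + t *\<^sub>R u"
    using q by (auto simp: mem_hull_pair)
  have t1: "t < 1" using t ne by (cases "t = 1") auto
  have D': "0 < orient b c a" "0 < orient c a b" using D by (simp_all add: orient_rotate)
  have "0 \<le> orient a b u" "0 \<le> orient b c u" "0 \<le> orient c a u"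
    using u D D' by (auto simp: orient_rotate)
  then show ?thesis
    using x t t1 by (auto simp: open_tri_def orient_affine intro!: add_pos_nonneg)
qed

lemma corner_notin_open_tri: "u \<in> {a, b, c} \<Longrightarrow> u \<notin> open_tri a b c"
  by (auto simp: open_tri_def)

lemma open_tri_subset:
  assumes x: "x \<in> open_tri a b c" and D: "0 < orient a b c"
  shows "open_tri a b x \<subseteq> open_tri a b c"
proof
  fix q assume q: "q \<in> open_tri a b x"
  have D': "0 < orient a b x" using x by (simp add: open_tri_def)
  \<comment> \<open>Both identities are three-term Pluecker relations; every product on the right is
    positive.\<close>
  have 1: "orient b c q * orient a b x = orient b x q * orient a b c + orient a b q * orient b c x"
    by (simp add: orient_def algebra_simps)
  have 2: "orient c a q * orient a b x = orient x a q * orient a b c + orient a b q * orient c a x"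
    by (simp add: orient_def algebra_simps)
  have "0 < orient b c q * orient a b x" "0 < orient c a q * orient a b x"
    unfolding 1 2 using q x D by (auto simp: open_tri_def intro!: add_pos_pos)
  then have "0 < orient b c q" "0 < orient c a q"
    using D' by (simp_all add: zero_less_mult_iff)
  then show "q \<in> open_tri a b c" using q by (simp add: open_tri_def)
qed

text \<open>The spokes to \<open>a\<close> and \<open>b\<close> are sides of the triangle
  \<open>a b x\<close>; the spoke to \<open>c\<close> runs on the outer side of the line through
  \<open>b\<close> and \<open>x\<close>.\<close>

lemma spoke_disjoint_open_tri:
  assumes x: "x \<in> open_tri a b c" and u: "u \<in> {a, b, c}"
  shows "convex hull {x, u} \<inter> open_tri a b x = {}"
proof -
  have "q \<notin> open_tri a b x" if q: "q \<in> convex hull {x, u}" for q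
  proof -
    obtain t where t: "0 \<le> t" "t \<le> 1" "q = (1 - t) *\<^sub>R x + t *\<^sub>R u"
      using q by (auto simp: mem_hull_pair)
    have "orient b x c \<le> 0"
      using x orient_swap[of b x c] by (simp add: open_tri_def)
    then have "orient b x q \<le> 0 \<or> orient x a q \<le> 0"
      using u t by (auto simp: orient_affine mult_nonneg_nonpos)
    then show ?thesis by (auto simp: open_tri_def)
  qed
  then show ?thesis by blast
qed

lemma centroid_in_open_tri:
  assumes "0 < orient a b c"
  shows "(1/3) *\<^sub>R (a + b + c) \<in> open_tri a b c"
proof -
  have "orient a b ((1/3) *\<^sub>R (a + b + c)) = orient a b c / 3"
    "orient b c ((1/3) *\<^sub>R (a + b + c)) = orient a b c / 3"
    "orient c a ((1/3) *\<^sub>R (a + b + c)) = orient a b c / 3"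
    by (simp_all add: orient_def field_simps)
  then show ?thesis using assms by (simp add: open_tri_def)
qed

section \<open>Empty faces under insertion of a vertex\<close>

definition empty_face :: "nat set \<Rightarrow> nat set set \<Rightarrow> (nat \<Rightarrow> point) \<Rightarrow> nat \<Rightarrow> nat \<Rightarrow> nat \<Rightarrow> bool" where
  "empty_face V E p a b c \<longleftrightarrow> a \<in> V \<and> b \<in> V \<and> c \<in> V \<and> 0 < orient (p a) (p b) (p c) \<and>
     p ` V \<inter> open_tri (p a) (p b) (p c) = {} \<and>
     (\<forall>e\<in>E. convex hull (p ` e) \<inter> open_tri (p a) (p b) (p c) = {})"

lemma empty_face_rotate: "empty_face V E p a b c \<Longrightarrow> empty_face V E p b c a"
  by (auto simp: empty_face_def open_tri_rotate orient_rotate)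

text \<open>Except for its corner, a spoke stays in the open triangle, where the old drawing has no
  point. So it meets old edges only in shared corners, and two spokes can meet only at
  \<open>x\<close>.\<close>

lemma crossing_free_insert:
  assumes cf: "crossing_free V E p" and E: "E \<subseteq> Pow V" and z: "z \<notin> V"
    and face: "empty_face V E p a b c" and x: "x \<in> open_tri (p a) (p b) (p c)"
  shows "crossing_free (insert z V) (E \<union> (\<lambda>u. {z, u}) ` {a, b, c}) (p(z := x))"
proof -
  let ?T = "open_tri (p a) (p b) (p c)" and ?p = "p(z := x)"
  have V: "a \<in> V" "b \<in> V" "c \<in> V" and D: "0 < orient (p a) (p b) (p c)"
    and eV: "\<And>v. v \<in> V \<Longrightarrow> p v \<notin> ?T"
    and eE: "\<And>e q. e \<in> E \<Longrightarrow> q \<in> convex hull (p ` e) \<Longrightarrow> q \<notin> ?T"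
    using face by (auto simp: empty_face_def)
  have inj: "inj_on p V" using cf by (simp add: crossing_free_def)
  have old: "?p ` e = p ` e" if "e \<subseteq> V" for e
    using that z by (intro image_cong) auto
  have new: "?p ` {z, u} = {x, p u}" if "u \<in> V" for u
    using that z by auto
  have sp: "q \<in> ?T \<or> q = p u" if "u \<in> {a, b, c}" "q \<in> convex hull {x, p u}" for u q
    using segment_to_corner[OF D x, of "p u" q] that by blast
  have oldnew: "convex hull (p ` e) \<inter> convex hull {x, p u} \<subseteq> p ` (e \<inter> {z, u})"
    if e: "e \<in> E" and u: "u \<in> {a, b, c}" for e u
  proof
    fix q assume q: "q \<in> convex hull (p ` e) \<inter> convex hull {x, p u}"
    then have "q = p u" using sp[OF u] eE[OF e] by blast
    moreover have "u \<in> V" using u V by blast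
    ultimately have "u \<in> e" using q cf e unfolding crossing_free_def by blast
    then show "q \<in> p ` (e \<inter> {z, u})" using \<open>q = p u\<close> by blast
  qed
  \<comment> \<open>A common point of two spokes, with the larger parameter on the spoke to
    \<open>p u\<close>: solving for \<open>p u\<close> puts this corner on the spoke to
    \<open>p v\<close>, which \<open>sp\<close> forbids. The conclusion follows from this
    contradiction.\<close>
  have *: "q = x" if u: "u \<in> {a, b, c}" and v: "v \<in> {a, b, c}" and "u \<noteq> v"
    and s: "0 < s" "q = (1 - s) *\<^sub>R x + s *\<^sub>R p u"
    and t: "0 \<le> t" "t \<le> s" "q = (1 - t) *\<^sub>R x + t *\<^sub>R p v" for u v q s t
  proof -
    have "s *\<^sub>R p u = (s - t) *\<^sub>R x + t *\<^sub>R p v" using s t by (simp add: algebra_simps)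
    then have "(1/s) *\<^sub>R (s *\<^sub>R p u) = (1/s) *\<^sub>R ((s - t) *\<^sub>R x + t *\<^sub>R p v)" by simp
    then have "p u = (1 - t/s) *\<^sub>R x + (t/s) *\<^sub>R p v"
      using s by (simp add: scaleR_add_right diff_divide_distrib)
    then have "p u \<in> convex hull {x, p v}"
      unfolding mem_hull_pair using s t by (intro exI[of _ "t/s"]) auto
    moreover have "p u \<noteq> p v" "p u \<notin> ?T" using u v V inj \<open>u \<noteq> v\<close> eV by (auto simp: inj_on_eq_iff)
    ultimately show ?thesis using sp[OF v] by blast
  qed
  have newnew: "convex hull {x, p u} \<inter> convex hull {x, p v} \<subseteq> {x}"
    if u: "u \<in> {a, b, c}" and v: "v \<in> {a, b, c}" and "u \<noteq> v" for u v
  proof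
    fix q assume "q \<in> convex hull {x, p u} \<inter> convex hull {x, p v}"
    then obtain s t where s: "0 \<le> s" "q = (1 - s) *\<^sub>R x + s *\<^sub>R p u"
      and t: "0 \<le> t" "q = (1 - t) *\<^sub>R x + t *\<^sub>R p v" by (auto simp: mem_hull_pair)
    have "q = x"
    proof (cases "s = 0 \<or> t = 0")
      case True then show ?thesis using s t by auto
    next
      case False
      then show ?thesis
        using *[OF u v \<open>u \<noteq> v\<close> _ s(2) t(1) _ t(2)] *[OF v u _ _ t(2) s(1) _ s(2)] \<open>u \<noteq> v\<close> s t
        by linarith
    qed
    then show "q \<in> {x}" by simp
  qed
  show ?thesis
    unfolding crossing_free_def
  proof (intro conjI ballI impI)
    show "inj_on ?p (insert z V)"
      using inj z x eV by (auto simp: inj_on_def)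
  next
    fix e w assume e: "e \<in> E \<union> (\<lambda>u. {z, u}) ` {a, b, c}" and w: "w \<in> insert z V - e"
    show "?p w \<notin> convex hull (?p ` e)"
    proof (cases "e \<in> E")
      case True
      then have e': "?p ` e = p ` e" using E old by blast
      show ?thesis
        unfolding e' using w True x eE[OF True] cf by (auto simp: crossing_free_def)
    next
      case False
      then obtain u where u: "u \<in> {a, b, c}" "e = {z, u}" using e by blast
      then have e': "?p ` e = {x, p u}" using new V by blast
      have "w \<in> V" "w \<noteq> u" "u \<in> V" "w \<noteq> z" using w u V by auto
      then show ?thesis
        unfolding e' using sp[OF u(1), of "p w"] eV[of w] inj_on_eq_iff[OF inj, of w u] by auto
    qed
  next
    fix e f assume e: "e \<in> E \<union> (\<lambda>u. {z, u}) ` {a, b, c}"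
      and f: "f \<in> E \<union> (\<lambda>u. {z, u}) ` {a, b, c}" and "e \<noteq> f"
    have mixed: "convex hull (?p ` e) \<inter> convex hull (?p ` f) \<subseteq> ?p ` (e \<inter> f)"
      if e: "e \<in> E" and f: "f \<in> (\<lambda>u. {z, u}) ` {a, b, c}" for e f
    proof -
      obtain u where u: "u \<in> {a, b, c}" "f = {z, u}" using f by blast
      have "e \<subseteq> V" "u \<in> V" using E e u V by auto
      then have "?p ` e = p ` e" "?p ` f = {x, p u}" "?p ` (e \<inter> f) = p ` (e \<inter> f)"
        using old[of e] old[of "e \<inter> f"] new[of u] u by auto
      then show ?thesis using oldnew[OF e u(1)] u by simp
    qed
    consider "e \<in> E" "f \<in> E" | "e \<in> E" "f \<in> (\<lambda>u. {z, u}) ` {a, b, c}"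
      | "f \<in> E" "e \<in> (\<lambda>u. {z, u}) ` {a, b, c}"
      | "e \<in> (\<lambda>u. {z, u}) ` {a, b, c}" "f \<in> (\<lambda>u. {z, u}) ` {a, b, c}"
      using e f by blast
    then show "convex hull (?p ` e) \<inter> convex hull (?p ` f) \<subseteq> ?p ` (e \<inter> f)"
    proof cases
      case 1
      then have "?p ` e = p ` e" "?p ` f = p ` f" "?p ` (e \<inter> f) = p ` (e \<inter> f)"
        using E by (intro old; blast)+
      then show ?thesis using 1 \<open>e \<noteq> f\<close> cf by (simp add: crossing_free_def)
    next
      case 2 then show ?thesis by (rule mixed)
    next
      case 3 then show ?thesis using mixed[of f e] by (simp add: Int_commute)
    next
      case 4
      then obtain u v where u: "u \<in> {a, b, c}" "e = {z, u}" and v: "v \<in> {a, b, c}" "f = {z, v}"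
        by blast
      have "?p ` e = {x, p u}" "?p ` f = {x, p v}" using u v V new by blast+
      moreover have "x \<in> ?p ` (e \<inter> f)" using u v by auto
      ultimately show ?thesis using newnew[OF u(1) v(1)] u v \<open>e \<noteq> f\<close> by auto
    qed
  qed
qed

text \<open>Of the three triangles around the new vertex, the one over the side \<open>a b\<close>
  is recorded: the next vertex of a path over that side will enter it. The other two arise by
  rotating the corners.\<close>

lemma empty_face_insert:
  assumes E: "E \<subseteq> Pow V" and z: "z \<notin> V"
    and face: "empty_face V E p a b c" and x: "x \<in> open_tri (p a) (p b) (p c)"
  shows "empty_face (insert z V) (E \<union> (\<lambda>u. {z, u}) ` {a, b, c}) (p(z := x)) a b z"
proof -
  have V: "a \<in> V" "b \<in> V" "c \<in> V" and D: "0 < orient (p a) (p b) (p c)"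
    using face by (auto simp: empty_face_def)
  let ?p = "p(z := x)"
  have sub: "open_tri (p a) (p b) x \<subseteq> open_tri (p a) (p b) (p c)"
    using open_tri_subset[OF x D] .
  have abz: "?p a = p a" "?p b = p b" "?p c = p c" "?p z = x" using V z by auto
  have old: "?p ` e = p ` e" if "e \<subseteq> V" for e
    using that z by (intro image_cong) auto
  have "convex hull (?p ` e) \<inter> open_tri (p a) (p b) x = {}"
    if e: "e \<in> E \<union> (\<lambda>u. {z, u}) ` {a, b, c}" for e
  proof (cases "e \<in> E")
    case True
    then have "?p ` e = p ` e" using E old by blast
    moreover have "convex hull (p ` e) \<inter> open_tri (p a) (p b) (p c) = {}"
      using True face unfolding empty_face_def by blast
    ultimately show ?thesis using sub by auto
  next
    case False
    then obtain u where u: "u \<in> {a, b, c}" "e = {z, u}" using e by blast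
    then have "?p ` e = {x, p u}" using V z by auto
    then show ?thesis using spoke_disjoint_open_tri[OF x, of "p u"] u by auto
  qed
  moreover have "?p ` insert z V \<inter> open_tri (p a) (p b) x = {}"
    using old[of V] sub face corner_notin_open_tri[of x "p a" "p b" x]
    unfolding empty_face_def by auto
  ultimately show ?thesis
    unfolding empty_face_def abz using V x by (auto simp: open_tri_def)
qed

text \<open>The new spokes leave the open triangle \<open>a b c\<close> only at old vertices, and
  these are already outside the other face.\<close>

lemma empty_face_insert_other:
  assumes E: "E \<subseteq> Pow V" and z: "z \<notin> V"
    and face: "empty_face V E p a b c" and x: "x \<in> open_tri (p a) (p b) (p c)"
    and face': "empty_face V E p a' b' c'"
    and disj: "open_tri (p a) (p b) (p c) \<inter> open_tri (p a') (p b') (p c') = {}"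
  shows "empty_face (insert z V) (E \<union> (\<lambda>u. {z, u}) ` {a, b, c}) (p(z := x)) a' b' c'"
proof -
  have V: "a \<in> V" "b \<in> V" "c \<in> V" and D: "0 < orient (p a) (p b) (p c)"
    and V': "a' \<in> V" "b' \<in> V" "c' \<in> V"
    using face face' by (auto simp: empty_face_def)
  let ?p = "p(z := x)"
  have abz: "?p a' = p a'" "?p b' = p b'" "?p c' = p c'" using V' z by auto
  have old: "?p ` e = p ` e" if "e \<subseteq> V" for e
    using that z by (intro image_cong) auto
  have "convex hull (?p ` e) \<inter> open_tri (p a') (p b') (p c') = {}"
    if e: "e \<in> E \<union> (\<lambda>u. {z, u}) ` {a, b, c}" for e
  proof (cases "e \<in> E")
    case True
    then have "?p ` e = p ` e" using E old by blast
    then show ?thesis using True face' unfolding empty_face_def by auto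
  next
    case False
    then obtain u where u: "u \<in> {a, b, c}" "e = {z, u}" using e by blast
    then have "?p ` e = {x, p u}" "u \<in> V" using V z by auto
    moreover have "q \<notin> open_tri (p a') (p b') (p c')" if "q \<in> convex hull {x, p u}" for q
    proof (cases "q = p u")
      case True then show ?thesis using face' \<open>u \<in> V\<close> unfolding empty_face_def by auto
    next
      case False
      have "p u \<in> {p a, p b, p c}" using u by auto
      from segment_to_corner[OF D x this that False] show ?thesis using disj by blast
    qed
    ultimately show ?thesis by auto
  qed
  moreover have "?p ` insert z V \<inter> open_tri (p a') (p b') (p c') = {}"
    using old[of V] face' x disj unfolding empty_face_def by auto
  ultimately show ?thesis
    using face' unfolding empty_face_def abz by auto
qed

section \<open>The stacked graph and its planarity\<close>

text \<open>On the side from \<open>b\<close> to \<open>c\<close> the function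
  \<open>orient b c\<close> vanishes; on the side from \<open>a\<close> to \<open>b\<close> it does
  so only at \<open>b\<close>.\<close>

lemma sides_meet_in_corner:
  assumes "0 < orient a b c"
  shows "convex hull {a, b} \<inter> convex hull {b, c} \<subseteq> {b}"
proof
  fix q assume q: "q \<in> convex hull {a, b} \<inter> convex hull {b, c}"
  then obtain t s where t: "q = (1 - t) *\<^sub>R a + t *\<^sub>R b" and s: "q = (1 - s) *\<^sub>R b + s *\<^sub>R c"
    unfolding Int_iff mem_hull_pair by blast
  have "orient b c q = 0" unfolding s by (simp add: orient_affine)
  then have "(1 - t) * orient b c a = 0" unfolding t by (simp add: orient_affine)
  then have "t = 1" using assms orient_rotate[of b c a] by simp
  then show "q \<in> {b}" using t by simp
qed

lemma crossing_free_triangle: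
  assumes D: "0 < orient (p 0) (p 1) (p (2::nat))"
  shows "crossing_free {0, 1, 2} {{0, 1}, {1, 2}, {0, 2}} p"
    and "empty_face {0, 1, 2} {{0, 1}, {1, 2}, {0, 2}} p 0 1 2"
proof -
  have D': "0 < orient (p 1) (p 2) (p 0)" "0 < orient (p 2) (p 0) (p 1)"
    using D by (simp_all add: orient_rotate)
  have ne: "p 0 \<noteq> p 1" "p 1 \<noteq> p 2" "p 0 \<noteq> p 2"
    using D D' by auto
  have S: "convex hull {p 0, p 1} \<inter> convex hull {p 1, p 2} \<subseteq> {p 1}"
    "convex hull {p 1, p 2} \<inter> convex hull {p 0, p 2} \<subseteq> {p 2}"
    "convex hull {p 0, p 2} \<inter> convex hull {p 0, p 1} \<subseteq> {p 0}"
    using sides_meet_in_corner[OF D] sides_meet_in_corner[OF D'(1)] sides_meet_in_corner[OF D'(2)]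
    by (simp_all add: insert_commute)
  have H: "p 2 \<in> convex hull {p 1, p 2}" "p 0 \<in> convex hull {p 0, p 2}" "p 1 \<in> convex hull {p 0, p 1}"
    by (simp_all add: hull_inc)
  have W: "p 2 \<notin> convex hull {p 0, p 1}" "p 0 \<notin> convex hull {p 1, p 2}" "p 1 \<notin> convex hull {p 0, p 2}"
    using subsetD[OF S(1), of "p 2"] subsetD[OF S(2), of "p 0"] subsetD[OF S(3), of "p 1"] H ne by auto
  have I: "{0, 1} \<inter> {1, 2} = {1::nat}" "{0, 1} \<inter> {0, 2} = {0::nat}" "{1, 2} \<inter> {0, 2} = {2::nat}"
    by auto
  have I': "{1, 2} \<inter> {0, 1} = {1::nat}" "{0, 2} \<inter> {0, 1} = {0::nat}" "{0, 2} \<inter> {1, 2} = {2::nat}"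
    by auto
  have S': "convex hull {p 1, p 2} \<inter> convex hull {p 0, p 1} \<subseteq> {p 1}"
    "convex hull {p 0, p 2} \<inter> convex hull {p 1, p 2} \<subseteq> {p 2}"
    "convex hull {p 0, p 1} \<inter> convex hull {p 0, p 2} \<subseteq> {p 0}"
    using S by blast+
  show "crossing_free {0, 1, 2} {{0, 1}, {1, 2}, {0, 2}} p"
    unfolding crossing_free_def
  proof (intro conjI ballI impI)
    show "inj_on p {0, 1, 2}" using ne by (auto simp: inj_on_def)
  next
    fix e w assume "e \<in> {{0, 1}, {1, 2}, {0, 2::nat}}" "w \<in> {0, 1, 2} - e"
    then consider "e = {0, 1}" "w = 2" | "e = {1, 2}" "w = 0" | "e = {0, 2}" "w = 1" by blast
    then show "p w \<notin> convex hull (p ` e)"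
      using W by cases simp_all
  next
    fix e f assume "e \<in> {{0, 1}, {1, 2}, {0, 2::nat}}" "f \<in> {{0, 1}, {1, 2}, {0, 2::nat}}" "e \<noteq> f"
    then show "convex hull (p ` e) \<inter> convex hull (p ` f) \<subseteq> p ` (e \<inter> f)"
      by (elim insertE emptyE) (simp_all only: I I' S S' image_insert image_empty simp_thms)
  qed
  have side: "convex hull {u, v} \<inter> open_tri u v w = {}" for u v w
    by (auto simp: mem_hull_pair open_tri_def orient_affine)
  have "convex hull {p 0, p 1} \<inter> open_tri (p 0) (p 1) (p 2) = {}"
    "convex hull {p 1, p 2} \<inter> open_tri (p 0) (p 1) (p 2) = {}"
    "convex hull {p 0, p 2} \<inter> open_tri (p 0) (p 1) (p 2) = {}"
    using side[of "p 0" "p 1" "p 2"] side[of "p 1" "p 2" "p 0"] side[of "p 2" "p 0" "p 1"]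
    by (simp_all add: open_tri_rotate insert_commute)
  then show "empty_face {0, 1, 2} {{0, 1}, {1, 2}, {0, 2}} p 0 1 2"
    using D by (auto simp: empty_face_def corner_notin_open_tri)
qed

text \<open>The line through \<open>b\<close> and \<open>x\<close> separates the two
  triangles.\<close>

lemma open_tri_fan_disjoint: "open_tri a b x \<inter> open_tri b c x = {}"
proof -
  have "orient b x q = - orient x b q" for q by (simp add: orient_def algebra_simps)
  then show ?thesis by (auto simp: open_tri_def)
qed

text \<open>The hubs are \<open>0, 1, 2\<close>, vertex \<open>3\<close> lies inside the hub triangle, and a vertex \<open>m \<ge> 4\<close> prolongs the path
  over the side \<open>m mod 3\<close>, \<open>(m + 1) mod 3\<close>, whose last vertex so far is \<open>prev_vertex m\<close>.\<close>

definition prev_vertex :: "nat \<Rightarrow> nat" where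
  "prev_vertex m = (if m = 3 then 2 else if m < 7 then 3 else m - 3)"

text \<open>The neighbours of \<open>m\<close> at the time of its insertion. The value 2 of
  \<open>prev_vertex 3\<close> makes them the three hubs for \<open>m = 3\<close>.\<close>

definition corners :: "nat \<Rightarrow> nat set" where
  "corners m = {m mod 3, Suc m mod 3, prev_vertex m}"

definition stacked_edges :: "nat \<Rightarrow> nat set set" where
  "stacked_edges n = {{0, 1}, {1, 2}, {0, 2}} \<union> (\<Union>m\<in>{3..<n}. (\<lambda>u. {m, u}) ` corners m)"

lemma corners_less: "3 \<le> m \<Longrightarrow> u \<in> corners m \<Longrightarrow> u < m"
  by (auto simp: corners_def prev_vertex_def)

lemma simple_graph_stacked: "3 \<le> n \<Longrightarrow> simple_graph {..<n} (stacked_edges n)"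
  unfolding simple_graph_def stacked_edges_def
proof (intro conjI ballI)
  fix e assume n: "3 \<le> n" and "e \<in> {{0, 1}, {1, 2}, {0, 2}} \<union> (\<Union>m\<in>{3..<n}. (\<lambda>u. {m, u}) ` corners m)"
  then show "\<exists>u v. u \<in> {..<n} \<and> v \<in> {..<n} \<and> u \<noteq> v \<and> e = {u, v}"
  proof (elim UnE UN_E imageE insertE emptyE)
    assume "e = {0, 1}"
    then show ?thesis using n by (intro exI[of _ 0] exI[of _ 1]) simp
  next
    assume "e = {1, 2}"
    then show ?thesis using n by (intro exI[of _ 1] exI[of _ 2]) simp
  next
    assume "e = {0, 2}"
    then show ?thesis using n by (intro exI[of _ 0] exI[of _ 2]) simp
  next
    fix m u assume "m \<in> {3..<n}" "u \<in> corners m" "e = {m, u}"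
    then show ?thesis using corners_less[of m u] by (intro exI[of _ m] exI[of _ u]) simp
  qed
qed simp

lemma stacked_edges_subset: "3 \<le> n \<Longrightarrow> stacked_edges n \<subseteq> Pow {..<n}"
  using simple_graph_stacked[of n] unfolding simple_graph_def by fastforce

lemma stacked_edges_Suc:
  assumes "3 \<le> n"
  shows "stacked_edges (Suc n) = stacked_edges n \<union> (\<lambda>u. {n, u}) ` corners n"
proof -
  have "{3..<Suc n} = insert n {3..<n}" using assms by auto
  then show ?thesis by (auto simp: stacked_edges_def)
qed

abbreviation next_face :: "(nat \<Rightarrow> point) \<Rightarrow> nat \<Rightarrow> point set" where
  "next_face p m \<equiv> open_tri (p (m mod 3)) (p (Suc m mod 3)) (p (prev_vertex m))"

text \<open>The induction invariant. The next three vertices represent the three residues mod 3,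
  hence the three sides of the hub triangle. Over each side an empty face is waiting, and
  disjointness keeps two of them intact while the third is filled.\<close>

definition stacked_drawing :: "nat \<Rightarrow> (nat \<Rightarrow> point) \<Rightarrow> bool" where
  "stacked_drawing n p \<longleftrightarrow> crossing_free {..<n} (stacked_edges n) p \<and>
     (\<forall>m\<in>{n..n+2}. empty_face {..<n} (stacked_edges n) p (m mod 3) (Suc m mod 3) (prev_vertex m)) \<and>
     (\<forall>m\<in>{n..n+2}. \<forall>m'\<in>{n..n+2}. m \<noteq> m' \<longrightarrow> next_face p m \<inter> next_face p m' = {})"

lemma stacked_drawing_4: "\<exists>p. stacked_drawing 4 p"
proof -
  define p :: "nat \<Rightarrow> point" where
    "p i = (if i = 0 then vector [0, 0] else if i = 1 then vector [1, 0] else vector [0, 1])" for i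
  have D: "0 < orient (p 0) (p 1) (p 2)"
    by (simp add: p_def orient_def)
  let ?E = "{{0, 1}, {1, 2}, {0, 2::nat}}"
  obtain x where x: "x \<in> open_tri (p 0) (p 1) (p 2)" using centroid_in_open_tri[OF D] by blast
  note cf = crossing_free_triangle(1)[of p, OF D]
  note face = crossing_free_triangle(2)[of p, OF D]
  have E: "?E \<subseteq> Pow {0, 1, 2}" by auto
  have V4: "{..<4} = insert 3 {0, 1, 2::nat}" by auto
  have E4: "stacked_edges 4 = ?E \<union> (\<lambda>u. {3, u}) ` {0, 1, 2}"
    using stacked_edges_Suc[of 3] by (simp add: stacked_edges_def corners_def prev_vertex_def)
  have rot: "{1, 2, 0} = {0, 1, 2::nat}" "{2, 0, 1} = {0, 1, 2::nat}" by auto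
  let ?p = "p(3 := x)"
  have cf4: "crossing_free {..<4} (stacked_edges 4) ?p"
    unfolding V4 E4 by (rule crossing_free_insert[OF cf E _ face x]) simp
  have f1: "empty_face {..<4} (stacked_edges 4) ?p 0 1 3"
    unfolding V4 E4 by (rule empty_face_insert[OF E _ face x]) simp
  have "empty_face {..<4} (?E \<union> (\<lambda>u. {3, u}) ` {1, 2, 0}) ?p 1 2 3"
    unfolding V4 by (rule empty_face_insert[OF E _ empty_face_rotate[OF face]])
      (use x in \<open>simp_all add: open_tri_rotate\<close>)
  then have f2: "empty_face {..<4} (stacked_edges 4) ?p 1 2 3"
    unfolding E4 rot .
  have "empty_face {..<4} (?E \<union> (\<lambda>u. {3, u}) ` {2, 0, 1}) ?p 2 0 3"
    unfolding V4 by (rule empty_face_insert[OF E _ empty_face_rotate[OF empty_face_rotate[OF face]]])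
      (use x in \<open>simp_all add: open_tri_rotate\<close>)
  then have f3: "empty_face {..<4} (stacked_edges 4) ?p 2 0 3"
    unfolding E4 rot .
  \<comment> \<open>Vertices 4, 5, 6 stand over the sides 12, 20, 01 of the hub triangle, and each
    has 3 as the last vertex of its path.\<close>
  have M: "{4..4+2} = {4, 5, 6::nat}" by auto
  have m: "4 mod 3 = (1::nat)" "Suc 4 mod 3 = 2" "prev_vertex 4 = 3"
    "5 mod 3 = (2::nat)" "Suc 5 mod 3 = 0" "prev_vertex 5 = 3"
    "6 mod 3 = (0::nat)" "Suc 6 mod 3 = 1" "prev_vertex 6 = 3"
    by (simp_all add: prev_vertex_def)
  have "stacked_drawing 4 ?p"
    unfolding stacked_drawing_def M
  proof (intro conjI)
    show "\<forall>m\<in>{4, 5, 6}. empty_face {..<4} (stacked_edges 4) ?p (m mod 3) (Suc m mod 3) (prev_vertex m)"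
      using f1 f2 f3 by (simp only: m ball_simps simp_thms)
    have d: "open_tri (?p 0) (?p 1) (?p 3) \<inter> open_tri (?p 1) (?p 2) (?p 3) = {}"
      "open_tri (?p 1) (?p 2) (?p 3) \<inter> open_tri (?p 2) (?p 0) (?p 3) = {}"
      "open_tri (?p 2) (?p 0) (?p 3) \<inter> open_tri (?p 0) (?p 1) (?p 3) = {}"
      by (rule open_tri_fan_disjoint)+
    then show "\<forall>m\<in>{4, 5, 6}. \<forall>m'\<in>{4, 5, 6}. m \<noteq> m' \<longrightarrow> next_face ?p m \<inter> next_face ?p m' = {}"
      unfolding ball_simps m by (simp add: Int_commute)
  qed (fact cf4)
  then show ?thesis by blast
qed

text \<open>Vertex \<open>n\<close> goes into its own face. The two other faces persist, and the
  face over the same side shrinks and is handed on to vertex \<open>n + 3\<close>.\<close>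

lemma stacked_drawing_Suc:
  assumes n: "4 \<le> n" and p: "stacked_drawing n p"
  shows "\<exists>q. stacked_drawing (Suc n) q"
proof -
  have face: "empty_face {..<n} (stacked_edges n) p (m mod 3) (Suc m mod 3) (prev_vertex m)"
    if "m \<in> {n..n+2}" for m
    using p that unfolding stacked_drawing_def by blast
  have disj: "next_face p m \<inter> next_face p m' = {}"
    if "m \<in> {n..n+2}" "m' \<in> {n..n+2}" "m \<noteq> m'" for m m'
    using p that unfolding stacked_drawing_def by blast
  have cf: "crossing_free {..<n} (stacked_edges n) p"
    using p unfolding stacked_drawing_def by blast
  have nin: "n \<in> {n..n+2}" by simp
  have D: "0 < orient (p (n mod 3)) (p (Suc n mod 3)) (p (prev_vertex n))"
    using face[OF nin] by (simp add: empty_face_def)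
  obtain x where x: "x \<in> next_face p n" using centroid_in_open_tri[OF D] by blast
  let ?q = "p(n := x)"
  have E: "stacked_edges n \<subseteq> Pow {..<n}" using stacked_edges_subset n by simp
  have nn: "n \<notin> {..<n}" by simp
  have S: "{..<Suc n} = insert n {..<n}" by auto
  have ES: "stacked_edges (Suc n) = stacked_edges n \<union> (\<lambda>u. {n, u}) ` {n mod 3, Suc n mod 3, prev_vertex n}"
    using stacked_edges_Suc n by (simp add: corners_def)
  have cf': "crossing_free {..<Suc n} (stacked_edges (Suc n)) ?q"
    unfolding S ES by (rule crossing_free_insert[OF cf E nn face[OF nin] x])
  have old: "empty_face {..<Suc n} (stacked_edges (Suc n)) ?q (m mod 3) (Suc m mod 3) (prev_vertex m)"
    if m: "m \<in> {n, n+1, n+2}" "m \<noteq> n" for m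
  proof -
    have "m \<in> {n..n+2}" using m by auto
    then show ?thesis
      unfolding S ES using m
      by (intro empty_face_insert_other[OF E nn face[OF nin] x face disj[OF nin]]) auto
  qed
  \<comment> \<open>After three steps the same side recurs, with \<open>n\<close> as the last vertex
    of its path.\<close>
  have pv: "prev_vertex (n+3) = n" "(n+3) mod 3 = n mod 3" "Suc (n+3) mod 3 = Suc n mod 3"
    using n by (simp add: prev_vertex_def, simp, presburger)
  have new: "empty_face {..<Suc n} (stacked_edges (Suc n)) ?q ((n+3) mod 3) (Suc (n+3) mod 3) (prev_vertex (n+3))"
    unfolding S ES pv by (rule empty_face_insert[OF E nn face[OF nin] x])
  have less: "m mod 3 < n" "Suc m mod 3 < n" for m :: nat
    using n by (auto intro: less_le_trans[of _ 3])
  have qold: "next_face ?q m = next_face p m" if "m \<in> {n+1, n+2}" for m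
  proof -
    have "prev_vertex m \<noteq> n" "m mod 3 \<noteq> n" "Suc m mod 3 \<noteq> n"
      using that n less[of m] by (auto simp: prev_vertex_def)
    then show ?thesis by simp
  qed
  have "next_face ?q (n+3) = open_tri (p (n mod 3)) (p (Suc n mod 3)) x"
    unfolding pv using less[of n] by simp
  then have qnew: "next_face ?q (n+3) \<subseteq> next_face p n"
    using open_tri_subset[OF x D] by simp
  have M: "{Suc n..Suc n+2} = {n+1, n+2, n+3}" by auto
  have p: "next_face p (n+1) \<inter> next_face p (n+2) = {}" "next_face p (n+1) \<inter> next_face p n = {}"
    "next_face p (n+2) \<inter> next_face p n = {}"
    by (rule disj; simp)+
  have q: "next_face ?q (n+1) = next_face p (n+1)" "next_face ?q (n+2) = next_face p (n+2)"
    by (rule qold; simp)+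
  have d: "next_face ?q (n+1) \<inter> next_face ?q (n+2) = {}"
    "next_face ?q (n+1) \<inter> next_face ?q (n+3) = {}"
    "next_face ?q (n+2) \<inter> next_face ?q (n+3) = {}"
    using p qnew unfolding q by blast+
  have "stacked_drawing (Suc n) ?q"
    unfolding stacked_drawing_def
  proof (intro conjI ballI impI)
    fix m assume "m \<in> {Suc n..Suc n+2}"
    then consider "m = n+1" | "m = n+2" | "m = n+3" unfolding M by blast
    then show "empty_face {..<Suc n} (stacked_edges (Suc n)) ?q (m mod 3) (Suc m mod 3) (prev_vertex m)"
      using old[of m] new by cases auto
  next
    fix m m' assume "m \<in> {Suc n..Suc n+2}" "m' \<in> {Suc n..Suc n+2}" "m \<noteq> m'"
    then consider "m = n+1" "m' = n+2" | "m = n+1" "m' = n+3" | "m = n+2" "m' = n+3"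
      | "m' = n+1" "m = n+2" | "m' = n+1" "m = n+3" | "m' = n+2" "m = n+3" unfolding M by blast
    then show "next_face ?q m \<inter> next_face ?q m' = {}"
      by cases (simp_all only: d Int_commute[of "next_face ?q (n+3)"] Int_commute[of "next_face ?q (n+2)" "next_face ?q (n+1)"])
  qed (fact cf')
  then show ?thesis by blast
qed

lemma planar_stacked:
  assumes "4 \<le> n"
  shows "planar {..<n} (stacked_edges n)"
proof -
  have "\<exists>p. stacked_drawing n p"
    using assms
  proof (induction n rule: dec_induct)
    case base
    show ?case by (rule stacked_drawing_4)
  next
    case (step n)
    then show ?case using stacked_drawing_Suc[of n] by (elim exE) simp
  qed
  then obtain p where "crossing_free {..<n} (stacked_edges n) p"
    unfolding stacked_drawing_def by (elim exE conjE)
  then show ?thesis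
    using crossing_free_imp_planar[OF simple_graph_stacked] assms by simp
qed

section \<open>Nested triangles over an edge\<close>

lemma orient_zero_collinear:
  assumes "orient a b c = 0" "a \<noteq> b"
  shows "\<exists>t. c = (1 - t) *\<^sub>R a + t *\<^sub>R b"
proof -
  have "\<exists>t. t * (b$1 - a$1) = c$1 - a$1 \<and> t * (b$2 - a$2) = c$2 - a$2"
  proof (cases "a$1 = b$1")
    case True
    then have ne: "a$2 \<noteq> b$2" using assms(2) by (auto simp: vec_eq_iff forall_2)
    have "c$1 = a$1" using assms(1) True ne by (simp add: orient_def)
    then show ?thesis using True ne by (intro exI[of _ "(c$2 - a$2) / (b$2 - a$2)"]) simp
  next
    case False
    then show ?thesis
      using assms(1) by (intro exI[of _ "(c$1 - a$1) / (b$1 - a$1)"]) (simp add: orient_def field_simps)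
  qed
  then obtain t where "t * (b$1 - a$1) = c$1 - a$1" "t * (b$2 - a$2) = c$2 - a$2" by blast
  then have "c = (1 - t) *\<^sub>R a + t *\<^sub>R b"
    by (simp add: vec_eq_iff forall_2 algebra_simps)
  then show ?thesis ..
qed

text \<open>Cramer's rule. The coordinate at \<open>c\<close> is spelled out because its sign
  compares the sides of the line through \<open>a\<close> and \<open>b\<close> on which
  \<open>q\<close> and \<open>c\<close> lie.\<close>

lemma barycentric:
  assumes D: "orient a b c \<noteq> 0"
  obtains l m where "q = l *\<^sub>R a + m *\<^sub>R b + (orient a b q / orient a b c) *\<^sub>R c"
    and "l + m + orient a b q / orient a b c = 1"
proof -
  let ?D = "orient a b c"
  let ?l = "orient q b c / ?D" and ?m = "orient a q c / ?D" and ?n = "orient a b q / ?D"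
  have s: "orient q b c + orient a q c + orient a b q = ?D"
    by (simp add: orient_def algebra_simps)
  have "q $ i * ?D = orient q b c * a $ i + orient a q c * b $ i + orient a b q * c $ i" for i
    using exhaust_2[of i] by (auto simp: orient_def algebra_simps)
  then have "q $ i = (orient q b c * a $ i + orient a q c * b $ i + orient a b q * c $ i) / ?D" for i
    using D by (simp add: eq_divide_eq)
  then have "q = ?l *\<^sub>R a + ?m *\<^sub>R b + ?n *\<^sub>R c"
    by (simp add: vec_eq_iff add_divide_distrib)
  moreover have "?l + ?m + ?n = 1"
    using D s by (simp add: add_divide_distrib[symmetric])
  ultimately show ?thesis using that by blast
qed

lemma orient_combination:
  assumes "l + m + n = 1"
  shows "orient a b (l *\<^sub>R a + m *\<^sub>R b + n *\<^sub>R c) = n * orient a b c"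
proof -
  have l: "l = 1 - m - n" using assms by simp
  show ?thesis unfolding l by (simp add: orient_def algebra_simps)
qed

text \<open>Triangles over the common base \<open>u v\<close> with apexes in \<open>K\<close>. Later
  the base is a side of the hub triangle and \<open>K\<close> consists of the path vertices of one
  residue class.\<close>

locale fan =
  fixes V :: "nat set" and E :: "nat set set" and p :: "nat \<Rightarrow> point" and u v :: nat and K :: "nat set"
  assumes drawing: "crossing_free V E p"
    and uv: "u \<in> V" "v \<in> V" "u \<noteq> v" "{u, v} \<in> E"
    and K: "K \<subseteq> V" "u \<notin> K" "v \<notin> K"
    and spokes: "\<And>k. k \<in> K \<Longrightarrow> {k, u} \<in> E" "\<And>k. k \<in> K \<Longrightarrow> {k, v} \<in> E"
begin

abbreviation side :: "nat \<Rightarrow> real" where "side k \<equiv> orient (p u) (p v) (p k)"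

abbreviation tri :: "nat \<Rightarrow> point set" where "tri k \<equiv> convex hull {p u, p v, p k}"

lemma vertex_avoids_edge:
  assumes "{a, b} \<in> E" "w \<in> V" "w \<noteq> a" "w \<noteq> b"
  shows "p w \<notin> convex hull {p a, p b}"
proof -
  have "p w \<notin> convex hull (p ` {a, b})"
    using drawing[unfolded crossing_free_def, THEN conjunct2, THEN conjunct1, THEN bspec, OF assms(1)]
      assms by simp
  then show ?thesis by simp
qed

lemma disjoint_edges:
  assumes "{a, b} \<in> E" "{c, d} \<in> E" "a \<noteq> c" "a \<noteq> d" "b \<noteq> c" "b \<noteq> d"
  shows "convex hull {p a, p b} \<inter> convex hull {p c, p d} = {}"
proof -
  have ne: "{a, b} \<noteq> {c, d}" and i: "{a, b} \<inter> {c, d} = {}" using assms by auto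
  have "convex hull (p ` {a, b}) \<inter> convex hull (p ` {c, d}) \<subseteq> p ` ({a, b} \<inter> {c, d})"
    using drawing[unfolded crossing_free_def, THEN conjunct2, THEN conjunct2, THEN bspec, OF assms(1),
        THEN bspec, OF assms(2)] ne by (rule mp)
  then show ?thesis unfolding i by simp
qed

lemma inV: "k \<in> K \<Longrightarrow> k \<in> V" "k \<in> K \<Longrightarrow> k \<noteq> u" "k \<in> K \<Longrightarrow> k \<noteq> v"
  using K by auto

text \<open>Of three collinear vertices one lies between the other two, hence on the edge joining
  them; the range of \<open>t\<close> tells which one.\<close>

lemma side_nonzero:
  assumes k: "k \<in> K"
  shows "side k \<noteq> 0"
proof
  assume "side k = 0"
  moreover have "p u \<noteq> p v"
    using drawing uv unfolding crossing_free_def by (auto dest: inj_onD)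
  ultimately obtain t where t: "p k = (1 - t) *\<^sub>R p u + t *\<^sub>R p v"
    using orient_zero_collinear by blast
  consider "t < 0" | "0 \<le> t" "t \<le> 1" | "1 < t" by linarith
  then show False
  proof cases
    case 1
    have "(1 - t) *\<^sub>R p u = p k - t *\<^sub>R p v" using t by simp
    then have "(1 / (1 - t)) *\<^sub>R ((1 - t) *\<^sub>R p u) = (1 / (1 - t)) *\<^sub>R (p k - t *\<^sub>R p v)" by simp
    then have "p u = (1 / (1 - t)) *\<^sub>R p k - (t / (1 - t)) *\<^sub>R p v"
      using 1 by (simp add: scaleR_diff_right)
    moreover have "1 - - t / (1 - t) = 1 / (1 - t)" using 1 by (simp add: field_simps)
    ultimately have "p u = (1 - - t / (1 - t)) *\<^sub>R p k + (- t / (1 - t)) *\<^sub>R p v"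
      by simp
    moreover have "0 \<le> - t / (1 - t)" "- t / (1 - t) \<le> 1" using 1 by (simp_all add: field_simps)
    ultimately have "p u \<in> convex hull {p k, p v}"
      unfolding mem_hull_pair by blast
    then show False using vertex_avoids_edge[OF spokes(2)[OF k], of u] uv inV[OF k] by auto
  next
    case 2
    then have "p k \<in> convex hull {p u, p v}" using t unfolding mem_hull_pair by blast
    then show False using vertex_avoids_edge[OF uv(4), of k] inV[OF k] by auto
  next
    case 3
    have "t *\<^sub>R p v = p k - (1 - t) *\<^sub>R p u" using t by simp
    then have "(1 / t) *\<^sub>R (t *\<^sub>R p v) = (1 / t) *\<^sub>R (p k - (1 - t) *\<^sub>R p u)" by simp
    then have "p v = (1 / t) *\<^sub>R p k - ((1 - t) / t) *\<^sub>R p u"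
      using 3 by (simp add: scaleR_diff_right)
    moreover have "1 - (t - 1) / t = 1 / t" "- ((1 - t) / t) = (t - 1) / t"
      using 3 by (simp_all add: field_simps)
    ultimately have "p v = (1 - (t - 1) / t) *\<^sub>R p k + ((t - 1) / t) *\<^sub>R p u"
      by (metis diff_conv_add_uminus scaleR_minus_left)
    moreover have "0 \<le> (t - 1) / t" "(t - 1) / t \<le> 1" using 3 by (simp_all add: field_simps)
    ultimately have "p v \<in> convex hull {p k, p u}"
      unfolding mem_hull_pair by blast
    then show False using vertex_avoids_edge[OF spokes(1)[OF k], of v] uv inV[OF k] by auto
  qed
qed

text \<open>Moving the negative term to the left and normalising exhibits one point on both the edge
  from \<open>k\<close> to \<open>Y\<close> and the edge from \<open>l\<close> to \<open>X\<close>,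
  which share no end. The disjunction covers both roles of the hubs.\<close>

lemma crossing_spokes:
  assumes k: "k \<in> K" and l: "l \<in> K" "k \<noteq> l"
    and q: "p k = a *\<^sub>R X + b *\<^sub>R Y + c *\<^sub>R p l" "a + b + c = 1" "0 < c" "0 < a" "b < 0"
    and XY: "(X = p u \<and> Y = p v) \<or> (X = p v \<and> Y = p u)"
  shows False
proof -
  let ?z = "(1 / (1 - b)) *\<^sub>R (p k - b *\<^sub>R Y)"
  have "1 - (- b) / (1 - b) = 1 / (1 - b)" using q by (simp add: field_simps)
  then have "?z = (1 - (- b) / (1 - b)) *\<^sub>R p k + ((- b) / (1 - b)) *\<^sub>R Y"
    by (simp add: scaleR_diff_right)
  moreover have "0 \<le> (- b) / (1 - b)" "(- b) / (1 - b) \<le> 1" using q by (simp_all add: field_simps)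
  ultimately have 1: "?z \<in> convex hull {p k, Y}" unfolding mem_hull_pair by blast
  have ab: "1 - b = a + c" using q by simp
  have "?z = (1 / (a + c)) *\<^sub>R (a *\<^sub>R X + c *\<^sub>R p l)" unfolding ab using q(1) by simp
  also have "\<dots> = (1 - a / (a + c)) *\<^sub>R p l + (a / (a + c)) *\<^sub>R X"
  proof -
    have "1 - a / (a + c) = c / (a + c)" using q by (simp add: field_simps)
    then show ?thesis by (simp add: scaleR_add_right)
  qed
  finally have "?z = (1 - a / (a + c)) *\<^sub>R p l + (a / (a + c)) *\<^sub>R X" .
  moreover have "0 \<le> a / (a + c)" "a / (a + c) \<le> 1" using q by (simp_all add: field_simps)
  ultimately have 2: "?z \<in> convex hull {p l, X}" unfolding mem_hull_pair by blast
  have "convex hull {p k, p u} \<inter> convex hull {p l, p v} = {}"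
    "convex hull {p k, p v} \<inter> convex hull {p l, p u} = {}"
    using disjoint_edges[OF spokes(1)[OF k] spokes(2)[OF l(1)]]
      disjoint_edges[OF spokes(2)[OF k] spokes(1)[OF l(1)]] inV[OF k] inV[OF l(1)] l(2) uv(3) by auto
  then show False using 1 2 XY by blast
qed

text \<open>Of the barycentric coordinates of \<open>p k\<close> with respect to \<open>u\<close>,
  \<open>v\<close>, \<open>l\<close> the last is positive. Opposite signs of the first two mean
  crossing spokes. If both are nonnegative, \<open>p k\<close> is in \<open>tri l\<close>; if both
  are nonpositive, solving for \<open>p l\<close> puts it into \<open>tri k\<close>.\<close>

lemma nested_total:
  assumes k: "k \<in> K" and l: "l \<in> K" and "k \<noteq> l" and same: "0 < side k * side l"
  shows "p k \<in> tri l \<or> p l \<in> tri k"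
proof -
  let ?n = "side k / side l"
  have n: "0 < ?n" using same by (simp add: zero_less_divide_iff zero_less_mult_iff)
  obtain a b where q: "p k = a *\<^sub>R p u + b *\<^sub>R p v + ?n *\<^sub>R p l" and s: "a + b + ?n = 1"
    using barycentric[OF side_nonzero[OF l]] .
  have "\<not> (0 < a \<and> b < 0)"
    using crossing_spokes[OF k l \<open>k \<noteq> l\<close> q s n] by blast
  moreover have "p k = b *\<^sub>R p v + a *\<^sub>R p u + ?n *\<^sub>R p l" "b + a + ?n = 1" using q s by (simp_all add: add.commute)
  then have "\<not> (0 < b \<and> a < 0)"
    using crossing_spokes[OF k l \<open>k \<noteq> l\<close>, of b "p v" a "p u" ?n] n by blast
  ultimately consider "0 \<le> a" "0 \<le> b" | "a \<le> 0" "b \<le> 0" by linarith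
  then show ?thesis
  proof cases
    case 1
    then have "p k \<in> tri l" unfolding convex_hull_3 using q s n less_imp_le by blast
    then show ?thesis ..
  next
    case 2
    define n where "n = ?n"
    have n0: "0 < n" using n n_def by simp
    have "n *\<^sub>R p l = p k - a *\<^sub>R p u - b *\<^sub>R p v"
      unfolding n_def by (subst q) simp
    then have "(1/n) *\<^sub>R (n *\<^sub>R p l) = (1/n) *\<^sub>R (p k - a *\<^sub>R p u - b *\<^sub>R p v)" by simp
    then have "p l = (- a / n) *\<^sub>R p u + (- b / n) *\<^sub>R p v + (1 / n) *\<^sub>R p k"
      using n0 by (simp add: scaleR_diff_right)
    moreover have "0 \<le> - a / n" "0 \<le> - b / n" "0 \<le> 1 / n"
      using 2 n0 by (simp_all add: divide_nonpos_pos)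
    moreover have "- a / n + - b / n + 1 / n = 1" using s n0 n_def[symmetric] by (simp add: field_simps)
    ultimately have "p l \<in> tri k" unfolding convex_hull_3 by blast
    then show ?thesis ..
  qed
qed

text \<open>A vanishing coordinate would place \<open>p k\<close> on a side of the triangle, that
  is, on an edge.\<close>

lemma nested_coefficients:
  assumes k: "k \<in> K" and l: "l \<in> K" and "k \<noteq> l" and kl: "p k \<in> tri l"
  obtains a b c where "0 < a" "0 < b" "0 < c" "a + b + c = 1" "p k = a *\<^sub>R p u + b *\<^sub>R p v + c *\<^sub>R p l"
proof -
  obtain a b c where abc: "0 \<le> a" "0 \<le> b" "0 \<le> c" "a + b + c = 1" "p k = a *\<^sub>R p u + b *\<^sub>R p v + c *\<^sub>R p l"
    using kl unfolding convex_hull_3 by blast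
  have "a \<noteq> 0"
  proof
    assume "a = 0"
    then have "c = 1 - b" "b \<le> 1" using abc by auto
    then have "p k = (1 - b) *\<^sub>R p l + b *\<^sub>R p v" using abc \<open>a = 0\<close> by simp
    then have "p k \<in> convex hull {p l, p v}" unfolding mem_hull_pair using abc \<open>b \<le> 1\<close> by blast
    then show False using vertex_avoids_edge[OF spokes(2)[OF l], of k] inV[OF k] \<open>k \<noteq> l\<close> by auto
  qed
  moreover have "b \<noteq> 0"
  proof
    assume "b = 0"
    then have "c = 1 - a" "a \<le> 1" using abc by auto
    then have "p k = (1 - a) *\<^sub>R p l + a *\<^sub>R p u" using abc \<open>b = 0\<close> by simp
    then have "p k \<in> convex hull {p l, p u}" unfolding mem_hull_pair using abc \<open>a \<le> 1\<close> by blast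
    then show False using vertex_avoids_edge[OF spokes(1)[OF l], of k] inV[OF k] \<open>k \<noteq> l\<close> by auto
  qed
  moreover have "c \<noteq> 0"
  proof
    assume "c = 0"
    then have "a = 1 - b" "b \<le> 1" using abc by auto
    then have "p k = (1 - b) *\<^sub>R p u + b *\<^sub>R p v" using abc \<open>c = 0\<close> by simp
    then have "p k \<in> convex hull {p u, p v}" unfolding mem_hull_pair using abc \<open>b \<le> 1\<close> by blast
    then show False using vertex_avoids_edge[OF uv(4), of k] inV[OF k] \<open>k \<noteq> l\<close> by auto
  qed
  ultimately show ?thesis using that[of a b c] abc by simp
qed

text \<open>The factor is the coordinate at \<open>l\<close>: the inner apex is on the same side of
  the base line and strictly closer to it.\<close>

lemma nested_side:
  assumes k: "k \<in> K" and l: "l \<in> K" and "k \<noteq> l" and kl: "p k \<in> tri l"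
  shows "\<exists>c. 0 < c \<and> c < 1 \<and> side k = c * side l"
proof -
  obtain a b c where abc: "0 < a" "0 < b" "0 < c" "a + b + c = 1" "p k = a *\<^sub>R p u + b *\<^sub>R p v + c *\<^sub>R p l"
    using nested_coefficients[OF assms] .
  show ?thesis
    using abc orient_combination[OF abc(4), of "p u" "p v" "p l"] by (intro exI[of _ c]) simp
qed

text \<open>Mutual nesting would make the product of two factors below 1 equal to 1.\<close>

lemma nested_antisym:
  assumes k: "k \<in> K" and l: "l \<in> K" and "k \<noteq> l" and "p k \<in> tri l"
  shows "p l \<notin> tri k"
proof
  assume "p l \<in> tri k"
  obtain c where c: "0 < c" "c < 1" "side k = c * side l"
    using nested_side[OF k l \<open>k \<noteq> l\<close> \<open>p k \<in> tri l\<close>] by blast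
  obtain d where d: "0 < d" "d < 1" "side l = d * side k"
    using nested_side[OF l k _ \<open>p l \<in> tri k\<close>] \<open>k \<noteq> l\<close> by blast
  have "side k * (1 - c * d) = 0" using c d by (simp add: algebra_simps)
  moreover have "c * d < 1" using c d by (metis less_trans mult.right_neutral mult_strict_left_mono)
  ultimately show False using side_nonzero[OF k] by simp
qed

text \<open>The frontier of the triangle consists of three edges disjoint from the edge
  \<open>k l\<close>, and a connected set avoiding the frontier lies wholly inside or wholly
  outside.\<close>

lemma adjacent_nested_iff:
  assumes k: "k \<in> K" and l: "l \<in> K" and m: "m \<in> K" and "m \<noteq> k" "m \<noteq> l" and e: "{k, l} \<in> E"
  shows "p k \<in> tri m \<longleftrightarrow> p l \<in> tri m"
proof -
  let ?S = "convex hull {p k, p l}"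
  have "?S \<inter> convex hull {p u, p v} = {}"
    using disjoint_edges[OF e uv(4)] inV[OF k] inV[OF l] by simp
  moreover have "?S \<inter> convex hull {p m, p v} = {}"
    using disjoint_edges[OF e spokes(2)[OF m]] inV[OF k] inV[OF l] assms by simp
  moreover have "?S \<inter> convex hull {p m, p u} = {}"
    using disjoint_edges[OF e spokes(1)[OF m]] inV[OF k] inV[OF l] assms by simp
  moreover have "frontier (tri m) = convex hull {p u, p v} \<union> convex hull {p m, p v} \<union> convex hull {p m, p u}"
    unfolding frontier_of_triangle[of "p u" "p v" "p m", simplified] segment_convex_hull
    by (simp only: insert_commute[of "p v" "p m"])
  ultimately have F: "?S \<inter> frontier (tri m) = {}" by blast
  have con: "connected ?S" by (simp add: convex_connected)
  have "p k \<in> ?S" "p l \<in> ?S" by (simp_all add: hull_inc)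
  then show ?thesis using connected_Int_frontier[OF con, of "tri m"] F by blast
qed

text \<open>Two ends on a common side of the base line are nested, say \<open>k\<close> in the
  triangle of \<open>k'\<close>. By adjacency \<open>l\<close> lies in that triangle too, hence on
  the side of \<open>k'\<close>, although the edge \<open>k l\<close> crosses the base line.\<close>

lemma no_two_split_edges:
  assumes K4: "k \<in> K" "l \<in> K" "k' \<in> K" "l' \<in> K" and d: "k \<noteq> k'" "k \<noteq> l'" "l \<noteq> k'" "l \<noteq> l'"
    and e: "{k, l} \<in> E" "{k', l'} \<in> E"
    and s: "side k * side l < 0" "side k' * side l' < 0"
  shows False
proof -
  have aux: False
    if h: "k \<in> K" "l \<in> K" "k' \<in> K" "l' \<in> K" "k \<noteq> k'" "k \<noteq> l'" "l \<noteq> k'" "l \<noteq> l'"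
      "{k, l} \<in> E" "{k', l'} \<in> E" "side k * side l < 0" "side k' * side l' < 0"
      "0 < side k * side k'" "p k \<in> tri k'" for k l k' l'
  proof -
    have "p l \<in> tri k'"
      using adjacent_nested_iff[of k l k'] h by simp
    obtain c where "0 < c" "side l = c * side k'"
      using nested_side[OF h(2,3,7) \<open>p l \<in> tri k'\<close>] by (elim exE conjE)
    moreover from this have "0 < c * (side k')\<^sup>2" using side_nonzero[OF h(3)] by simp
    ultimately have "0 < side l * side k'" by (simp add: power2_eq_square mult.assoc)
    then show False using h by (auto simp: zero_less_mult_iff mult_less_0_iff)
  qed
  have aux2: False
    if "k \<in> K" "l \<in> K" "k' \<in> K" "l' \<in> K" "k \<noteq> k'" "k \<noteq> l'" "l \<noteq> k'" "l \<noteq> l'"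
      "{k, l} \<in> E" "{k', l'} \<in> E" "side k * side l < 0" "side k' * side l' < 0"
      "0 < side k * side k'" for k l k' l'
    using nested_total[of k k'] aux[of k l k' l'] aux[of k' l' k l] that
    by (auto simp: mult.commute)
  \<comment> \<open>Exchanging the ends of the second edge covers the case that \<open>k\<close>
    shares its side with \<open>l'\<close>.\<close>
  have e': "{l', k'} \<in> E" and s': "side l' * side k' < 0"
    using e(2) s(2) by (simp_all add: insert_commute mult.commute)
  have "0 < side k * side k' \<or> 0 < side k * side l'"
    using s by (auto simp: zero_less_mult_iff mult_less_0_iff)
  then show False
  proof
    assume "0 < side k * side k'"
    from aux2[OF K4 d e s this] show False .
  next
    assume "0 < side k * side l'"
    from aux2[OF K4(1,2,4,3) d(2,1,4,3) e(1) e' s(1) s' this] show False .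
  qed
qed

text \<open>If \<open>z\<close> is in the triangle of \<open>t\<close>, adjacency brings
  \<open>y\<close> and \<open>x\<close> into it; so \<open>t\<close>, and with it \<open>z\<close>,
  is outside that of \<open>x\<close>, and totality puts \<open>x\<close>, then \<open>y\<close>,
  into that of \<open>z\<close>. If instead \<open>t\<close> is in the triangle of \<open>z\<close>,
  then \<open>y\<close> is outside that of \<open>t\<close>, so \<open>t\<close> and with it
  \<open>z\<close> are in that of \<open>y\<close>; antisymmetry keeps \<open>y\<close>, hence
  \<open>x\<close>, out of that of \<open>z\<close>.\<close>

lemma path_nested:
  assumes K4: "x \<in> K" "y \<in> K" "z \<in> K" "t \<in> K" and d: "distinct [x, y, z, t]"
    and e: "{x, y} \<in> E" "{y, z} \<in> E" "{z, t} \<in> E"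
    and s: "0 < side x * side z" "0 < side y * side z" "0 < side t * side z"
  shows "(p x \<in> tri z \<and> p y \<in> tri z \<and> p z \<in> tri t) \<or> (p z \<in> tri x \<and> p z \<in> tri y \<and> p t \<in> tri z)"
proof -
  have s': "0 < side y * side t" "0 < side x * side t" using s by (auto simp: zero_less_mult_iff)
  have tot: "p x \<in> tri z \<or> p z \<in> tri x" "p y \<in> tri z \<or> p z \<in> tri y" "p t \<in> tri z \<or> p z \<in> tri t"
    "p y \<in> tri t \<or> p t \<in> tri y"
    using nested_total[of x z] nested_total[of y z] nested_total[of t z] nested_total[of y t] K4 d s s'
    by auto
  have anti: "\<not> (p x \<in> tri z \<and> p z \<in> tri x)" "\<not> (p y \<in> tri z \<and> p z \<in> tri y)"
    "\<not> (p t \<in> tri z \<and> p z \<in> tri t)" "\<not> (p x \<in> tri t \<and> p t \<in> tri x)"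
    using nested_antisym[of x z] nested_antisym[of y z] nested_antisym[of t z] nested_antisym[of x t] K4 d
    by auto
  have adj: "p x \<in> tri z \<longleftrightarrow> p y \<in> tri z" "p y \<in> tri t \<longleftrightarrow> p z \<in> tri t" "p z \<in> tri y \<longleftrightarrow> p t \<in> tri y"
    "p z \<in> tri x \<longleftrightarrow> p t \<in> tri x" "p x \<in> tri t \<longleftrightarrow> p y \<in> tri t"
    using adjacent_nested_iff[of x y z] adjacent_nested_iff[of y z t] adjacent_nested_iff[of z t y]
      adjacent_nested_iff[of z t x] adjacent_nested_iff[of x y t] K4 d e
    by auto
  show ?thesis using tot anti adj by blast
qed

text \<open>The inner vertex is a positive combination of the hubs and the outer vertex, and the
  hubs contribute a positive amount to the value of the line. If \<open>p k\<close> is inner, the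
  total is 0 and \<open>p l\<close> must compensate; if \<open>p l\<close> is inner,
  \<open>p k\<close> contributes 0.\<close>

lemma nested_line_signs:
  fixes a :: point and b :: real
  assumes k: "k \<in> K" and l: "l \<in> K" and "k \<noteq> l" and on: "a \<bullet> p k = b"
    and pos: "0 \<le> a \<bullet> p u - b" "0 \<le> a \<bullet> p v - b" "0 < a \<bullet> p u - b \<or> 0 < a \<bullet> p v - b"
  shows "p k \<in> tri l \<Longrightarrow> a \<bullet> p l - b < 0" "p l \<in> tri k \<Longrightarrow> 0 < a \<bullet> p l - b"
proof -
  have comb: "a \<bullet> (r *\<^sub>R X + s *\<^sub>R Y + t *\<^sub>R Z) - b = r * (a \<bullet> X - b) + s * (a \<bullet> Y - b) + t * (a \<bullet> Z - b)"
    if "r + s + t = 1" for r s t :: real and X Y Z :: point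
  proof -
    have "b = r * b + s * b + t * b" using that by (metis distrib_right mult_1)
    then show ?thesis by (simp add: inner_add_right algebra_simps)
  qed
  have hub: "0 < r * (a \<bullet> p u - b) + s * (a \<bullet> p v - b)" if "0 < r" "0 < s" for r s :: real
    using pos that by (auto intro: add_pos_nonneg add_nonneg_pos)
  show "a \<bullet> p l - b < 0" if n: "p k \<in> tri l"
  proof -
    obtain r s t where c: "0 < r" "0 < s" "0 < t" "r + s + t = 1" "p k = r *\<^sub>R p u + s *\<^sub>R p v + t *\<^sub>R p l"
      using nested_coefficients[OF k l \<open>k \<noteq> l\<close> n] .
    have "t * (a \<bullet> p l - b) < 0"
      using comb[OF c(4), of "p u" "p v" "p l"] c(5) on hub[OF c(1,2)] by simp
    then show ?thesis using c(3) by (simp add: mult_less_0_iff)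
  qed
  show "0 < a \<bullet> p l - b" if n: "p l \<in> tri k"
  proof -
    obtain r s t where c: "0 < r" "0 < s" "0 < t" "r + s + t = 1" "p l = r *\<^sub>R p u + s *\<^sub>R p v + t *\<^sub>R p k"
      using nested_coefficients[OF l k not_sym[OF \<open>k \<noteq> l\<close>] n] .
    then show ?thesis
      using comb[OF c(4), of "p u" "p v" "p k"] on hub[OF c(1,2)] by simp
  qed
qed

end

section \<open>Alternating sequences of lines\<close>

unbundle cross3_syntax

text \<open>Cramer's rule for four vectors: each coefficient is the determinant of the other three,
  with alternating signs.\<close>

lemma cross3_dependency:
  fixes w x y z :: "real^3"
  shows "(x \<bullet> (y \<times> z)) *\<^sub>R w - (w \<bullet> (y \<times> z)) *\<^sub>R x + (w \<bullet> (x \<times> z)) *\<^sub>R y - (w \<bullet> (x \<times> y)) *\<^sub>R z = 0"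
  by (simp add: vec_eq_iff forall_3 cross3_def inner_vec_def sum_3 algebra_simps)

text \<open>Pairing with a point in homogeneous coordinates excludes the signs + - + followed by -
  or 0. Allowing \<open>d = 0\<close> admits families of concurrent or parallel lines, whose
  relations have three terms.\<close>

definition alternating :: "nat \<Rightarrow> (nat \<Rightarrow> real^3) \<Rightarrow> bool" where
  "alternating M Q \<longleftrightarrow> (\<forall>i j k l. i < j \<and> j < k \<and> k < l \<and> l < M \<longrightarrow>
     (\<exists>a b c d. 0 < a \<and> 0 < b \<and> 0 < c \<and> 0 \<le> d \<and>
        a *\<^sub>R Q i - b *\<^sub>R Q j + c *\<^sub>R Q k - d *\<^sub>R Q l = 0))"

text \<open>The triple determinants are the coefficients of Cramer's relation; the factor
  \<open>s\<close> treats both signs at once.\<close>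

lemma alternating_of_triple_signs:
  assumes pos: "\<And>i j k. i < j \<Longrightarrow> j < k \<Longrightarrow> k < M \<Longrightarrow> 0 < s * (Q i \<bullet> (Q j \<times> Q k))"
  shows "alternating M Q"
  unfolding alternating_def
proof (intro allI impI)
  fix i j k l assume h: "i < j \<and> j < k \<and> k < l \<and> l < M"
  let ?d = "\<lambda>i j k. s * (Q i \<bullet> (Q j \<times> Q k))"
  have "s *\<^sub>R ((Q j \<bullet> (Q k \<times> Q l)) *\<^sub>R Q i - (Q i \<bullet> (Q k \<times> Q l)) *\<^sub>R Q j
      + (Q i \<bullet> (Q j \<times> Q l)) *\<^sub>R Q k - (Q i \<bullet> (Q j \<times> Q k)) *\<^sub>R Q l) = 0"
    by (simp add: cross3_dependency)
  then have "?d j k l *\<^sub>R Q i - ?d i k l *\<^sub>R Q j + ?d i j l *\<^sub>R Q k - ?d i j k *\<^sub>R Q l = 0"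
    by (simp add: scaleR_add_right scaleR_diff_right)
  moreover have "0 < ?d j k l" "0 < ?d i k l" "0 < ?d i j l" "0 \<le> ?d i j k"
    using pos[of j k l] pos[of i k l] pos[of i j l] pos[of i j k] h by auto
  ultimately show "\<exists>a b c d. 0 < a \<and> 0 < b \<and> 0 < c \<and> 0 \<le> d \<and>
      a *\<^sub>R Q i - b *\<^sub>R Q j + c *\<^sub>R Q k - d *\<^sub>R Q l = 0"
    by blast
qed

text \<open>Cramer's relation for \<open>N\<close> and three of the vectors loses its
  \<open>N\<close> term because these are coplanar. The determinants of pairs with \<open>N\<close>
  remain as coefficients, and \<open>d = 0\<close>.\<close>

lemma alternating_of_pair_signs:
  assumes pos: "\<And>i j. i < j \<Longrightarrow> j < M \<Longrightarrow> 0 < s * (N \<bullet> (Q i \<times> Q j))"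
    and flat: "\<And>i j k. i < j \<Longrightarrow> j < k \<Longrightarrow> k < M \<Longrightarrow> Q i \<bullet> (Q j \<times> Q k) = 0"
  shows "alternating M Q"
  unfolding alternating_def
proof (intro allI impI)
  fix i j k l assume h: "i < j \<and> j < k \<and> k < l \<and> l < M"
  let ?d = "\<lambda>i j. s * (N \<bullet> (Q i \<times> Q j))"
  have "(- s) *\<^sub>R ((Q i \<bullet> (Q j \<times> Q k)) *\<^sub>R N - (N \<bullet> (Q j \<times> Q k)) *\<^sub>R Q i
      + (N \<bullet> (Q i \<times> Q k)) *\<^sub>R Q j - (N \<bullet> (Q i \<times> Q j)) *\<^sub>R Q k) = 0"
    by (simp add: cross3_dependency)
  then have "?d j k *\<^sub>R Q i - ?d i k *\<^sub>R Q j + ?d i j *\<^sub>R Q k - 0 *\<^sub>R Q l = 0"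
    using flat[of i j k] h by (simp add: scaleR_add_right scaleR_diff_right)
  moreover have "0 < ?d j k" "0 < ?d i k" "0 < ?d i j" "0 \<le> (0::real)"
    using h by (auto intro: pos)
  ultimately show "\<exists>a b c d. 0 < a \<and> 0 < b \<and> 0 < c \<and> 0 \<le> d \<and>
      a *\<^sub>R Q i - b *\<^sub>R Q j + c *\<^sub>R Q k - d *\<^sub>R Q l = 0"
    by blast
qed

section \<open>Ramsey's theorem for signs of determinants\<close>

lemma nsets_enumeration:
  assumes "H \<in> nsets A M"
  obtains f :: "nat \<Rightarrow> nat" where "strict_mono_on {..<M} f" "f ` {..<M} = H"
proof -
  have H: "finite H" "card H = M" using assms by (auto simp: nsets_def)
  let ?f = "\<lambda>i. sorted_list_of_set H ! i"
  have len: "length (sorted_list_of_set H) = M" using H by simp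
  have "strict_mono_on {..<M} ?f"
    using sorted_wrt_nth_less[OF strict_sorted_list_of_set, of _ _ H] len
    by (auto simp: monotone_on_def)
  moreover have "?f ` {..<M} = H"
    using nth_image[of M "sorted_list_of_set H"] H len by (simp add: lessThan_atLeast0)
  ultimately show ?thesis using that by blast
qed

text \<open>Triples are coloured by the sign of \<open>D\<close> at their increasing enumeration.
  The sizes are separate because the colour zero has to leave room for a second application of
  Ramsey's theorem.\<close>

lemma ramsey_triple_sign:
  fixes D :: "nat \<Rightarrow> nat \<Rightarrow> nat \<Rightarrow> real"
  assumes "partn_lst {..<n} [A, B, C] 3"
  obtains f M where "strict_mono_on {..<M} f" "f ` {..<M} \<subseteq> {..<n}"
    and "(M = A \<and> (\<forall>i j k. i < j \<and> j < k \<and> k < M \<longrightarrow> 0 < D (f i) (f j) (f k))) \<or>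
      (M = B \<and> (\<forall>i j k. i < j \<and> j < k \<and> k < M \<longrightarrow> D (f i) (f j) (f k) < 0)) \<or>
      (M = C \<and> (\<forall>i j k. i < j \<and> j < k \<and> k < M \<longrightarrow> D (f i) (f j) (f k) = 0))"
proof -
  define val where "val S = D (sorted_list_of_set S ! 0) (sorted_list_of_set S ! 1) (sorted_list_of_set S ! 2)" for S
  define col where "col S = (if 0 < val S then 0 else if val S < 0 then 1 else (2::nat))" for S
  have "col \<in> nsets {..<n} 3 \<rightarrow> {..<3}" by (auto simp: col_def)
  then obtain i H where i: "i < 3" and H: "H \<in> nsets {..<n} ([A, B, C] ! i)" "col ` nsets H 3 \<subseteq> {i}"
    using assms unfolding partn_lst_def monochromatic_def by (auto simp: numeral_3_eq_3)
  obtain f where f: "strict_mono_on {..<[A, B, C] ! i} f" "f ` {..<[A, B, C] ! i} = H"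
    using nsets_enumeration[OF H(1)] .
  have c: "col {f a, f b, f c} = i" and v: "val {f a, f b, f c} = D (f a) (f b) (f c)"
    if "a < b" "b < c" "c < [A, B, C] ! i" for a b c
  proof -
    have less: "f a < f b" "f b < f c" using f(1) that by (auto simp: monotone_on_def)
    have "{f a, f b, f c} \<in> nsets H 3" using less f(2) that by (auto simp: nsets_def)
    then show "col {f a, f b, f c} = i" using H(2) by blast
    have "sorted_list_of_set (set [f a, f b, f c]) = [f a, f b, f c]"
      by (rule sorted_list_of_set.idem_if_sorted_distinct) (use less in auto)
    then show "val {f a, f b, f c} = D (f a) (f b) (f c)" by (simp add: val_def)
  qed
  have col: "col S = 0 \<Longrightarrow> 0 < val S" "col S = 1 \<Longrightarrow> val S < 0" "col S = 2 \<Longrightarrow> val S = 0" for S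
    by (cases "0 < val S"; cases "val S < 0"; simp add: col_def)+
  have sub: "f ` {..<[A, B, C] ! i} \<subseteq> {..<n}" using H(1) f(2) by (auto simp: nsets_def)
  consider "i = 0" | "i = 1" | "i = 2" using i by linarith
  then show ?thesis
  proof cases
    case 1
    have P: "0 < D (f a) (f b) (f c)" if "a < b" "b < c" "c < A" for a b c
    proof -
      have "c < [A, B, C] ! i" using that 1 by simp
      then have "col {f a, f b, f c} = 0" "val {f a, f b, f c} = D (f a) (f b) (f c)"
        using c[OF that(1,2)] v[OF that(1,2)] 1 by blast+
      then show ?thesis using col by metis
    qed
    show ?thesis
    proof (rule that[of A f])
      show "strict_mono_on {..<A} f" "f ` {..<A} \<subseteq> {..<n}" using f(1) sub 1 by simp_all
    qed (use P in simp)
  next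
    case 2
    have P: "D (f a) (f b) (f c) < 0" if "a < b" "b < c" "c < B" for a b c
    proof -
      have "c < [A, B, C] ! i" using that 2 by simp
      then have "col {f a, f b, f c} = 1" "val {f a, f b, f c} = D (f a) (f b) (f c)"
        using c[OF that(1,2)] v[OF that(1,2)] 2 by blast+
      then show ?thesis using col by metis
    qed
    show ?thesis
    proof (rule that[of B f])
      show "strict_mono_on {..<B} f" "f ` {..<B} \<subseteq> {..<n}" using f(1) sub 2 by simp_all
    qed (use P in simp)
  next
    case 3
    have P: "D (f a) (f b) (f c) = 0" if "a < b" "b < c" "c < C" for a b c
    proof -
      have "c < [A, B, C] ! i" using that 3 by simp
      then have "col {f a, f b, f c} = 2" "val {f a, f b, f c} = D (f a) (f b) (f c)"
        using c[OF that(1,2)] v[OF that(1,2)] 3 by blast+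
      then show ?thesis using col by metis
    qed
    show ?thesis
    proof (rule that[of C f])
      show "strict_mono_on {..<C} f" "f ` {..<C} \<subseteq> {..<n}" using f(1) sub 3 by simp_all
    qed (use P in simp)
  qed
qed

text \<open>Two colours suffice: the value zero, merged with the negative ones, is excluded where
  the lemma is applied.\<close>

lemma ramsey_pair_sign:
  fixes D :: "nat \<Rightarrow> nat \<Rightarrow> real"
  assumes "partn_lst {..<n} [M, M] 2"
  obtains f where "strict_mono_on {..<M} f" "f ` {..<M} \<subseteq> {..<n}"
    and "(\<forall>i j. i < j \<and> j < M \<longrightarrow> 0 < D (f i) (f j)) \<or> (\<forall>i j. i < j \<and> j < M \<longrightarrow> D (f i) (f j) \<le> 0)"
proof -
  define val where "val S = D (Min S) (Max S)" for S
  define col where "col S = (if 0 < val S then 0 else (1::nat))" for S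
  have "col \<in> nsets {..<n} 2 \<rightarrow> {..<2}" by (auto simp: col_def)
  then obtain i H where i: "i < 2" and H: "H \<in> nsets {..<n} ([M, M] ! i)" "col ` nsets H 2 \<subseteq> {i}"
    using assms unfolding partn_lst_def monochromatic_def by (auto simp: numeral_2_eq_2)
  have "[M, M] ! i = M" using i by (cases i) auto
  then obtain f where f: "strict_mono_on {..<M} f" "f ` {..<M} = H"
    using nsets_enumeration[OF H(1)] by metis
  have cv: "col {f a, f b} = i \<and> val {f a, f b} = D (f a) (f b)" if "a < b" "b < M" for a b
  proof -
    have less: "f a < f b" using f(1) that by (auto simp: monotone_on_def)
    have "{f a, f b} \<in> nsets H 2" using less f(2) that by (auto simp: nsets_def)
    then have "col {f a, f b} = i" using H(2) by blast
    then show ?thesis using less by (simp add: val_def)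
  qed
  have sub: "f ` {..<M} \<subseteq> {..<n}" using H(1) f(2) by (auto simp: nsets_def)
  have "(\<forall>i j. i < j \<and> j < M \<longrightarrow> 0 < D (f i) (f j)) \<or> (\<forall>i j. i < j \<and> j < M \<longrightarrow> D (f i) (f j) \<le> 0)"
  proof (cases "i = 0")
    case True
    then have "0 < D (f a) (f b)" if "a < b" "b < M" for a b
      using cv[OF that] by (auto simp: col_def split: if_splits)
    then show ?thesis by blast
  next
    case False
    then have "D (f a) (f b) \<le> 0" if "a < b" "b < M" for a b
      using cv[OF that] by (auto simp: col_def split: if_splits)
    then show ?thesis by blast
  qed
  then show ?thesis using that f(1) sub by blast
qed

text \<open>The cross product of two vectors orthogonal to \<open>N\<close> is parallel to
  \<open>N\<close>; were it also orthogonal to \<open>N\<close>, it would vanish.\<close>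

lemma flat_normal_nonzero:
  fixes N x y :: "real^3"
  assumes "N \<noteq> 0" "N \<bullet> x = 0" "N \<bullet> y = 0" "x \<times> y \<noteq> 0"
  shows "N \<bullet> (x \<times> y) \<noteq> 0"
proof
  assume "N \<bullet> (x \<times> y) = 0"
  moreover have "N \<times> (x \<times> y) = 0" using assms by (simp add: Lagrange)
  ultimately show False using assms norm_and_cross_eq_0[of N "x \<times> y"] by blast
qed

lemma ramsey_alternating:
  "\<exists>R. \<forall>n\<ge>R. \<forall>P :: nat \<Rightarrow> real^3. (\<forall>i<n. \<forall>j<n. i \<noteq> j \<longrightarrow> P i \<times> P j \<noteq> 0) \<longrightarrow>
     (\<exists>f. strict_mono_on {..<M} f \<and> f ` {..<M} \<subseteq> {..<n} \<and> alternating M (\<lambda>i. P (f i)))"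
proof -
  obtain S0 :: nat where "partn_lst {..<S0} [M, M] 2" using ramsey_full by blast
  \<comment> \<open>The two extra elements guarantee the indices 0 and 1 from which \<open>N\<close>
    is formed below.\<close>
  then have S: "partn_lst {..<S0+2} [M, M] 2" by (rule partn_lst_greater_resource) simp
  obtain R :: nat where R: "partn_lst {..<R} [M, M, S0+2] 3" using ramsey_full by blast
  show ?thesis
  proof (intro exI[of _ R] allI impI)
    fix n and P :: "nat \<Rightarrow> real^3"
    assume "R \<le> n" and ind: "\<forall>i<n. \<forall>j<n. i \<noteq> j \<longrightarrow> P i \<times> P j \<noteq> 0"
    then have "partn_lst {..<n} [M, M, S0+2] 3" using R partn_lst_greater_resource by blast
    from ramsey_triple_sign[OF this, of "\<lambda>i j k. P i \<bullet> (P j \<times> P k)"]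
    obtain f m where f: "strict_mono_on {..<m} f" "f ` {..<m} \<subseteq> {..<n}"
      and D: "(m = M \<and> (\<forall>i j k. i < j \<and> j < k \<and> k < m \<longrightarrow> 0 < P (f i) \<bullet> (P (f j) \<times> P (f k)))) \<or>
      (m = M \<and> (\<forall>i j k. i < j \<and> j < k \<and> k < m \<longrightarrow> P (f i) \<bullet> (P (f j) \<times> P (f k)) < 0)) \<or>
      (m = S0+2 \<and> (\<forall>i j k. i < j \<and> j < k \<and> k < m \<longrightarrow> P (f i) \<bullet> (P (f j) \<times> P (f k)) = 0))"
      by metis
    from D show "\<exists>f. strict_mono_on {..<M} f \<and> f ` {..<M} \<subseteq> {..<n} \<and> alternating M (\<lambda>i. P (f i))"
    proof (elim disjE conjE)
      assume "m = M" "\<forall>i j k. i < j \<and> j < k \<and> k < m \<longrightarrow> 0 < P (f i) \<bullet> (P (f j) \<times> P (f k))"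
      then have "alternating M (\<lambda>i. P (f i))"
        by (intro alternating_of_triple_signs[where s=1]) auto
      then show ?thesis using f \<open>m = M\<close> by blast
    next
      assume "m = M" "\<forall>i j k. i < j \<and> j < k \<and> k < m \<longrightarrow> P (f i) \<bullet> (P (f j) \<times> P (f k)) < 0"
      then have "alternating M (\<lambda>i. P (f i))"
        by (intro alternating_of_triple_signs[where s="-1"]) auto
      then show ?thesis using f \<open>m = M\<close> by blast
    next
      assume m: "m = S0+2" and z: "\<forall>i j k. i < j \<and> j < k \<and> k < m \<longrightarrow> P (f i) \<bullet> (P (f j) \<times> P (f k)) = 0"
      \<comment> \<open>All chosen vectors lie in the plane orthogonal to \<open>N\<close>, so the
        orientation of pairs in this plane is what remains to be made uniform.\<close>
      define N where "N = P (f 0) \<times> P (f 1)"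
      have inj: "f i \<noteq> f j" if "i < j" "j < m" for i j
        using strict_mono_onD[OF f(1), of i j] that by auto
      have less: "f i < n" if "i < m" for i using f that by auto
      have ne: "P (f i) \<times> P (f j) \<noteq> 0" if "i < j" "j < m" for i j
        using ind less inj[OF that] that by (meson less_trans)
      have "N \<noteq> 0" using ne[of 0 1] m by (simp add: N_def)
      have perp: "N \<bullet> P (f i) = 0" if "i < m" for i
      proof -
        consider "i = 0" | "i = 1" | "1 < i" by linarith
        then show ?thesis
        proof cases
          case 3
          then have "P (f 0) \<bullet> (P (f 1) \<times> P (f i)) = 0" using z that by auto
          then show ?thesis unfolding N_def by (metis cross_triple inner_commute)
        qed (simp_all add: N_def dot_cross_self)
      qed
      have nz: "N \<bullet> (P (f i) \<times> P (f j)) \<noteq> 0" if "i < j" "j < m" for i j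
        using flat_normal_nonzero[OF \<open>N \<noteq> 0\<close> perp perp ne[OF that]] that by simp
      obtain g where g: "strict_mono_on {..<M} g" "g ` {..<M} \<subseteq> {..<m}"
        and G: "(\<forall>i j. i < j \<and> j < M \<longrightarrow> 0 < N \<bullet> (P (f (g i)) \<times> P (f (g j)))) \<or>
          (\<forall>i j. i < j \<and> j < M \<longrightarrow> N \<bullet> (P (f (g i)) \<times> P (f (g j))) \<le> 0)"
        using ramsey_pair_sign[OF S, of "\<lambda>i j. N \<bullet> (P (f i) \<times> P (f j))"] unfolding m by metis
      have gl: "g i < g j" "g j < m" if "i < j" "j < M" for i j
        using strict_mono_onD[OF g(1), of i j] g(2) that by auto
      have flat: "P (f (g i)) \<bullet> (P (f (g j)) \<times> P (f (g k))) = 0" if "i < j" "j < k" "k < M" for i j k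
        using z gl[of i j] gl[of j k] that by auto
      have "alternating M (\<lambda>i. P (f (g i)))"
        using G
      proof
        assume "\<forall>i j. i < j \<and> j < M \<longrightarrow> 0 < N \<bullet> (P (f (g i)) \<times> P (f (g j)))"
        then show ?thesis using flat by (intro alternating_of_pair_signs[where s=1 and N=N]) auto
      next
        assume "\<forall>i j. i < j \<and> j < M \<longrightarrow> N \<bullet> (P (f (g i)) \<times> P (f (g j))) \<le> 0"
        then have "N \<bullet> (P (f (g i)) \<times> P (f (g j))) < 0" if "i < j" "j < M" for i j
          using nz[OF gl[OF that]] that by (simp add: less_le)
        then show ?thesis using flat by (intro alternating_of_pair_signs[where s="-1" and N=N]) auto
      qed
      moreover have "strict_mono_on {..<M} (f \<circ> g)"
        using f(1) g by (auto simp: monotone_on_def image_subset_iff)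
      moreover have "(f \<circ> g) ` {..<M} \<subseteq> {..<n}" using f(2) g(2) by auto
      ultimately show ?thesis by (intro exI[of _ "f \<circ> g"]) simp
    qed
  qed
qed

section \<open>Blocks of lines\<close>

text \<open>Here \<open>h i\<close> will be the value of line \<open>i\<close> at a fixed hub. From
  four blocks of non-constant sign one could pick a nonzero value in the first and values of weakly
  alternating signs in the others, against the dependency.\<close>

lemma sign_constant_blocks:
  fixes h :: "nat \<Rightarrow> real"
  assumes alt: "\<And>i j k l. i < j \<Longrightarrow> j < k \<Longrightarrow> k < l \<Longrightarrow> l < m * N \<Longrightarrow>
      \<exists>a b c d. 0 < a \<and> 0 < b \<and> 0 < c \<and> 0 \<le> d \<and> a * h i - b * h j + c * h k - d * h l = 0"
  shows "card {b. b < N \<and> (\<exists>s<m. sgn (h (m * b + s)) \<noteq> sgn (h (m * b)))} \<le> 3" (is "card ?B \<le> 3")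
proof (rule ccontr)
  assume "\<not> card ?B \<le> 3"
  then have "4 \<le> card ?B" by simp
  then obtain T where T: "T \<subseteq> ?B" "card T = 4" "finite T"
    using obtain_subset_with_card_n by blast
  then have "T \<in> nsets ?B 4" by (simp add: nsets_def)
  then obtain f :: "nat \<Rightarrow> nat" where f: "strict_mono_on {..<4} f" "f ` {..<4} = T" by (rule nsets_enumeration)
  have lt: "f 0 < f 1" "f 1 < f 2" "f 2 < f 3"
    using strict_mono_onD[OF f(1), of 0 1] strict_mono_onD[OF f(1), of 1 2]
      strict_mono_onD[OF f(1), of 2 3] by simp_all
  have fB: "f r \<in> ?B" if "r < 4" for r using f(2) T(1) that by blast
  \<comment> \<open>If the sign is not constant on a block, both weak signs occur there and some
    value is nonzero.\<close>
  have ex: "\<exists>s<m. 0 \<le> e * h (m * f r + s)" "\<exists>s<m. h (m * f r + s) \<noteq> 0"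
    if r: "r < 4" and e: "e = 1 \<or> e = -1" for r and e :: real
  proof -
    obtain s where s: "s < m" "sgn (h (m * f r + s)) \<noteq> sgn (h (m * f r))"
      using fB[OF r] by blast
    then have m: "0 < m" by simp
    show "\<exists>s<m. 0 \<le> e * h (m * f r + s)"
    proof (rule ccontr)
      assume "\<not> ?thesis"
      then have "e * h (m * f r + s) < 0" "e * h (m * f r + 0) < 0" using s(1) m not_le by blast+
      then show False using s(2) e by (auto simp: sgn_if)
    qed
    show "\<exists>s<m. h (m * f r + s) \<noteq> 0"
    proof (rule ccontr)
      assume "\<not> ?thesis"
      then have "h (m * f r + s) = 0" "h (m * f r + 0) = 0" using s(1) m by blast+
      then show False using s(2) by simp
    qed
  qed
  have blk: "m * f r + s < m * f q + t" if "f r < f q" "s < m" for r q s t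
  proof -
    have "m * f r + s < m * Suc (f r)" using that by simp
    also have "\<dots> \<le> m * f q" using that by (intro mult_le_mono2) simp
    finally show ?thesis by simp
  qed
  \<comment> \<open>Strictness comes from the first block, whose coefficient is positive; weak signs
    suffice in the others, also when \<open>d = 0\<close>.\<close>
  obtain s0 where s0: "s0 < m" "h (m * f 0 + s0) \<noteq> 0" using ex(2)[of 0 1] by auto
  define e where "e = sgn (h (m * f 0 + s0))"
  have e: "e = 1 \<or> e = -1" "0 < e * h (m * f 0 + s0)" using s0(2) by (auto simp: e_def sgn_if)
  have ne: "- e = 1 \<or> - e = -1" using e by auto
  obtain s1 where s1: "s1 < m" "0 \<le> - e * h (m * f 1 + s1)" using ex(1)[of 1 "- e"] ne by auto
  obtain s2 where s2: "s2 < m" "0 \<le> e * h (m * f 2 + s2)" using ex(1)[of 2 e] e by auto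
  obtain s3 where s3: "s3 < m" "0 \<le> - e * h (m * f 3 + s3)" using ex(1)[of 3 "- e"] ne by auto
  have "m * f 3 + s3 < m * Suc (f 3)" using s3 by simp
  also have "\<dots> \<le> m * N" using fB[of 3] by (intro mult_le_mono2) simp
  finally obtain a b c d where abcd: "0 < a" "0 < b" "0 < c" "0 \<le> d"
    "a * h (m * f 0 + s0) - b * h (m * f 1 + s1) + c * h (m * f 2 + s2) - d * h (m * f 3 + s3) = 0"
    using alt[OF blk[OF lt(1) s0(1)] blk[OF lt(2) s1(1)] blk[OF lt(3) s2(1)]] by metis
  have "0 < a * (e * h (m * f 0 + s0))" "0 \<le> b * (- e * h (m * f 1 + s1))"
    "0 \<le> c * (e * h (m * f 2 + s2))" "0 \<le> d * (- e * h (m * f 3 + s3))"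
    using abcd e(2) s1(2) s2(2) s3(2) by (simp_all only: mult_pos_pos mult_nonneg_nonneg less_imp_le)
  moreover have "a * (e * h (m * f 0 + s0)) + b * (- e * h (m * f 1 + s1))
      + c * (e * h (m * f 2 + s2)) + d * (- e * h (m * f 3 + s3))
      = e * (a * h (m * f 0 + s0) - b * h (m * f 1 + s1) + c * h (m * f 2 + s2) - d * h (m * f 3 + s3))"
    by (simp add: algebra_simps)
  ultimately show False unfolding abcd(5) by simp
qed

text \<open>Block \<open>b\<close> owns the line indices \<open>12 * b, \<dots>, 12 * b + 11\<close>; its vertices of class \<open>j\<close>, listed
  along the path, receive the lines \<open>12 * b + 4 * j + s\<close> in the order \<open>s = 0, 2, 3, 1\<close>.\<close>

definition block_perm :: "nat \<Rightarrow> nat" where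
  "block_perm r = 4 * (r mod 3) + (if r < 3 then 0 else if r < 6 then 2 else if r < 9 then 3 else 1)"

text \<open>The shift by 6 preserves the class mod 3. Truncated subtraction makes the value constant
  below 6, so lines are prescribed only from vertex 6 on.\<close>

definition line_index :: "nat \<Rightarrow> nat" where
  "line_index v = 12 * ((v - 6) div 12) + block_perm ((v - 6) mod 12)"

lemma block_perm_less: "block_perm r < 12"
proof -
  have "r mod 3 < 3" by simp
  then show ?thesis unfolding block_perm_def by (auto split: if_splits)
qed

lemma block_perm_inj: "inj_on block_perm {..<12}"
proof (rule inj_on_inverseI)
  \<comment> \<open>The quotient by 4 recovers the class; the remainders 0, 2, 3, 1 recover the
    positions 0, 1, 2, 3 on the path.\<close>
  let ?g = "\<lambda>x. x div 4 + 3 * (if x mod 4 = 0 then 0 else if x mod 4 = 2 then 1 else if x mod 4 = 3 then 2 else 3)"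
  fix r :: nat assume "r \<in> {..<12}"
  then have "r = 0 \<or> r = 1 \<or> r = 2 \<or> r = 3 \<or> r = 4 \<or> r = 5 \<or> r = 6 \<or> r = 7 \<or> r = 8 \<or> r = 9 \<or> r = 10 \<or> r = 11"
    unfolding lessThan_iff by presburger
  then show "?g (block_perm r) = r"
    by (elim disjE) (simp_all add: block_perm_def)
qed

lemma line_index_inj: "inj_on line_index {6..}"
proof (rule inj_onI)
  fix v w :: nat assume vw: "v \<in> {6..}" "w \<in> {6..}" and eq: "line_index v = line_index w"
  have dm: "line_index x div 12 = (x - 6) div 12" "line_index x mod 12 = block_perm ((x - 6) mod 12)" for x
    using block_perm_less[of "(x - 6) mod 12"] by (simp_all add: line_index_def)
  have "(v - 6) div 12 = (w - 6) div 12" using dm(1) eq by metis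
  moreover have "block_perm ((v - 6) mod 12) = block_perm ((w - 6) mod 12)" using dm(2) eq by metis
  then have "(v - 6) mod 12 = (w - 6) mod 12" by (rule inj_onD[OF block_perm_inj]) simp_all
  ultimately have "v - 6 = w - 6" by (metis div_mult_mod_eq)
  then show "v = w" using vw by simp
qed

lemma line_index_less: "line_index v < 12 * N" if "v < 6 + 12 * N" "6 \<le> v"
proof -
  have "(v - 6) div 12 < N" using that by (simp add: div_less_iff_less_mult)
  then have "12 * Suc ((v - 6) div 12) \<le> 12 * N" by (intro mult_le_mono2) simp
  then show ?thesis using block_perm_less[of "(v - 6) mod 12"] by (simp add: line_index_def)
qed

text \<open>Position \<open>q\<close> within the block on the path of class \<open>j\<close>. As 6
  and 12 are multiples of 3, consecutive positions are consecutive on that path.\<close>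

definition block_vertex :: "nat \<Rightarrow> nat \<Rightarrow> nat \<Rightarrow> nat" where
  "block_vertex b j q = 6 + 12 * b + 3 * q + j"

lemma line_index_block:
  assumes j: "j < 3"
  shows "line_index (block_vertex b j 0) = 12 * b + 4 * j" "line_index (block_vertex b j 1) = 12 * b + 4 * j + 2"
    "line_index (block_vertex b j 2) = 12 * b + 4 * j + 3" "line_index (block_vertex b j 3) = 12 * b + 4 * j + 1"
proof -
  have j3: "j = 0 \<or> j = 1 \<or> j = 2" using j by linarith
  have *: "line_index (block_vertex b j q) = 12 * b + block_perm (3 * q + j)" if "q < 4" for q
  proof -
    have "block_vertex b j q - 6 = 12 * b + (3 * q + j)" "3 * q + j < 12"
      using that j by (simp_all add: block_vertex_def)
    then show ?thesis by (simp add: line_index_def)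
  qed
  show "line_index (block_vertex b j 0) = 12 * b + 4 * j" "line_index (block_vertex b j 1) = 12 * b + 4 * j + 2"
    "line_index (block_vertex b j 2) = 12 * b + 4 * j + 3" "line_index (block_vertex b j 3) = 12 * b + 4 * j + 1"
    using *[of 0] *[of 1] *[of 2] *[of 3] j3 by (elim disjE; simp add: block_perm_def)+
qed

lemma block_vertex_bounds:
  assumes "j < 3" "b < N" "q < 4"
  shows "6 \<le> block_vertex b j q" "block_vertex b j q < 6 + 12 * N" "block_vertex b j q mod 3 = j"
proof -
  have "12 * Suc b \<le> 12 * N" using assms by (intro mult_le_mono2) simp
  then show "6 \<le> block_vertex b j q" "block_vertex b j q < 6 + 12 * N"
    using assms by (simp_all add: block_vertex_def)
  have "block_vertex b j q = j + 3 * (2 + 4 * b + q)" by (simp add: block_vertex_def)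
  then show "block_vertex b j q mod 3 = j" using assms by (simp only: mod_mult_self2 mod_less)
qed

lemma fan_stacked:
  assumes cf: "crossing_free {..<n} (stacked_edges n) p" and n: "6 \<le> n" and j: "j < 3"
  shows "fan {..<n} (stacked_edges n) p j (Suc j mod 3) {k. 6 \<le> k \<and> k < n \<and> k mod 3 = j}"
proof
  have j3: "j = 0 \<or> j = 1 \<or> j = 2" using j by linarith
  then show "j \<in> {..<n}" "Suc j mod 3 \<in> {..<n}" "j \<noteq> Suc j mod 3" using n by auto
  have E: "{0, 1} \<in> stacked_edges n" "{1, 2} \<in> stacked_edges n" "{2, 0} \<in> stacked_edges n"
    unfolding stacked_edges_def by (simp_all add: insert_commute)
  from j3 show "{j, Suc j mod 3} \<in> stacked_edges n"
    using E by (elim disjE) (simp_all add: numeral_2_eq_2)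
  have sp: "{k, u} \<in> stacked_edges n" if "6 \<le> k" "k < n" "u \<in> corners k" for k u
    unfolding stacked_edges_def using that by (intro UnI2 UN_I[of k] imageI) auto
  fix k assume "k \<in> {k. 6 \<le> k \<and> k < n \<and> k mod 3 = j}"
  then have k: "6 \<le> k" "k < n" "k mod 3 = j" by auto
  show "{k, j} \<in> stacked_edges n"
    by (rule sp[OF k(1,2)]) (simp add: corners_def k(3))
  have "Suc k mod 3 = Suc j mod 3" using k(3) by (metis mod_Suc_eq)
  then show "{k, Suc j mod 3} \<in> stacked_edges n"
    by (intro sp[OF k(1,2)]) (simp add: corners_def)
qed (use assms in auto)

lemma path_edge_stacked:
  assumes "j < 3" "block_vertex b j (Suc q) < n"
  shows "{block_vertex b j q, block_vertex b j (Suc q)} \<in> stacked_edges n"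
proof -
  let ?k = "block_vertex b j (Suc q)"
  have "block_vertex b j q \<in> corners ?k"
    by (simp add: corners_def prev_vertex_def block_vertex_def)
  then have "{?k, block_vertex b j q} \<in> stacked_edges n"
    unfolding stacked_edges_def using assms
    by (intro UnI2 UN_I[of ?k] imageI) (auto simp: block_vertex_def)
  then show ?thesis by (simp add: insert_commute)
qed

section \<open>Non-existence of the drawing\<close>

lemma parallel_normals_same_line:
  fixes a a' :: point and b b' :: real
  assumes "a \<noteq> 0" and c: "a$1 * a'$2 = a$2 * a'$1" "a$2 * b' = b * a'$2" "b * a'$1 = a$1 * b'"
    and x: "a \<bullet> x = b"
  shows "a' \<bullet> x = b'"
proof -
  have x': "a$1 * x$1 + a$2 * x$2 = b" using x by (simp add: inner_vec_def sum_2)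
  \<comment> \<open>Both expressions are multiples of the equation of the first line, and one of
    \<open>a$1\<close>, \<open>a$2\<close> is nonzero.\<close>
  have "a$1 * (a'$1 * x$1 + a'$2 * x$2 - b') = a'$1 * (a$1 * x$1 + a$2 * x$2 - b)"
    "a$2 * (a'$1 * x$1 + a'$2 * x$2 - b') = a'$2 * (a$1 * x$1 + a$2 * x$2 - b)"
    using c by (simp_all add: algebra_simps)
  then have "a$1 * (a'$1 * x$1 + a'$2 * x$2 - b') = 0" "a$2 * (a'$1 * x$1 + a'$2 * x$2 - b') = 0"
    unfolding x' by simp_all
  moreover have "a$1 \<noteq> 0 \<or> a$2 \<noteq> 0" using \<open>a \<noteq> 0\<close> by (auto simp: vec_eq_iff forall_2)
  ultimately show ?thesis by (auto simp: inner_vec_def sum_2)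
qed

text \<open>Homogeneous coordinates of the line; pairing with \<open>(x$1, x$2, -1)\<close>
  evaluates its equation at \<open>x\<close>.\<close>

definition line_vector :: "point \<Rightarrow> real \<Rightarrow> real^3" where
  "line_vector a b = vector [a$1, a$2, b]"

lemma cross_line_vector_eq_0:
  "line_vector a b \<times> line_vector a' b' = 0 \<longleftrightarrow>
     a$1 * a'$2 = a$2 * a'$1 \<and> a$2 * b' = b * a'$2 \<and> b * a'$1 = a$1 * b'"
  by (auto simp: line_vector_def cross3_def vec_eq_iff forall_3)

lemma line_vector_inner: "line_vector a b \<bullet> vector [x$1, x$2, -1] = a \<bullet> x - b"
  by (simp add: line_vector_def inner_vec_def sum_2 sum_3)

text \<open>If the cross product vanishes, each equation implies the other. This turns distinct
  lines into the independent vectors that the Ramsey argument requires.\<close>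

lemma cross_line_vector_nonzero:
  assumes "a \<noteq> 0" "a' \<noteq> 0" "{x. a \<bullet> x = b} \<noteq> {x. a' \<bullet> x = b'}"
  shows "line_vector a b \<times> line_vector a' b' \<noteq> 0"
proof
  assume "line_vector a b \<times> line_vector a' b' = 0"
  then have c: "a$1 * a'$2 = a$2 * a'$1" "a$2 * b' = b * a'$2" "b * a'$1 = a$1 * b'"
    by (simp_all add: cross_line_vector_eq_0)
  then have "{x. a \<bullet> x = b} = {x. a' \<bullet> x = b'}"
    using parallel_normals_same_line[OF assms(1) c] parallel_normals_same_line[OF assms(2), of a b b']
    by (auto simp: mult.commute)
  then show False using assms(3) by contradiction
qed

text \<open>Cramer's rule for the difference of the two points forces the first minor to vanish; the
  other two minors are multiples of it.\<close>

lemma two_common_points: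
  assumes c: "line_vector a b \<times> line_vector a' b' \<noteq> 0"
    and x: "a \<bullet> x = b" "a' \<bullet> x = b'" and y: "a \<bullet> y = b" "a' \<bullet> y = b'"
  shows "x = y"
proof (rule ccontr)
  assume "x \<noteq> y"
  have e: "a$1 * x$1 + a$2 * x$2 = b" "a'$1 * x$1 + a'$2 * x$2 = b'"
    "a$1 * y$1 + a$2 * y$2 = b" "a'$1 * y$1 + a'$2 * y$2 = b'"
    using x y by (simp_all add: inner_vec_def sum_2)
  have "(a$1 * a'$2 - a$2 * a'$1) * (x$1 - y$1)
      = a'$2 * ((a$1 * x$1 + a$2 * x$2) - (a$1 * y$1 + a$2 * y$2))
        - a$2 * ((a'$1 * x$1 + a'$2 * x$2) - (a'$1 * y$1 + a'$2 * y$2))"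
    "(a$1 * a'$2 - a$2 * a'$1) * (x$2 - y$2)
      = a$1 * ((a'$1 * x$1 + a'$2 * x$2) - (a'$1 * y$1 + a'$2 * y$2))
        - a'$1 * ((a$1 * x$1 + a$2 * x$2) - (a$1 * y$1 + a$2 * y$2))"
    by (simp_all add: algebra_simps)
  then have "(a$1 * a'$2 - a$2 * a'$1) * (x$1 - y$1) = 0" "(a$1 * a'$2 - a$2 * a'$1) * (x$2 - y$2) = 0"
    unfolding e by simp_all
  moreover have "x$1 \<noteq> y$1 \<or> x$2 \<noteq> y$2" using \<open>x \<noteq> y\<close> by (auto simp: vec_eq_iff forall_2)
  ultimately have d: "a$1 * a'$2 - a$2 * a'$1 = 0" by auto
  have "a$2 * b' - b * a'$2 = - (a$1 * a'$2 - a$2 * a'$1) * x$1"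
    "b * a'$1 - a$1 * b' = - (a$1 * a'$2 - a$2 * a'$1) * x$2"
    unfolding e(1,2)[symmetric] by (simp_all add: algebra_simps)
  then show False using c d unfolding cross_line_vector_eq_0 by simp
qed

text \<open>If no sign is zero, two of the three agree; a zero can be paired with a nonzero sign.
  Any two of three hubs are cyclically adjacent, hence span a side.\<close>

lemma choose_side:
  fixes \<sigma> :: "nat \<Rightarrow> real"
  assumes s: "\<And>j. \<sigma> j \<in> {-1, 0, 1}"
    and z: "\<And>j k. j < 3 \<Longrightarrow> k < 3 \<Longrightarrow> j \<noteq> k \<Longrightarrow> \<not> (\<sigma> j = 0 \<and> \<sigma> k = 0)"
  shows "\<exists>j<3. \<exists>e\<in>{1, -1}. 0 \<le> e * \<sigma> j \<and> 0 \<le> e * \<sigma> (Suc j mod 3) \<and>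
    (0 < e * \<sigma> j \<or> 0 < e * \<sigma> (Suc j mod 3))"
proof -
  have n: "Suc 0 mod 3 = 1" "Suc 1 mod 3 = 2" "Suc 2 mod 3 = 0" by simp_all
  have j: "(\<exists>j<3. P j) \<longleftrightarrow> P 0 \<or> P 1 \<or> P (2::nat)" for P
    by (auto simp: less_Suc_eq numeral_3_eq_3 numeral_2_eq_2)
  have "\<not> (\<sigma> 0 = 0 \<and> \<sigma> 1 = 0)" "\<not> (\<sigma> 1 = 0 \<and> \<sigma> 2 = 0)" "\<not> (\<sigma> 0 = 0 \<and> \<sigma> 2 = 0)"
    by (rule z; simp)+
  then show ?thesis
    unfolding j n using s[of 0] s[of 1] s[of 2] by (elim insertE emptyE) simp_all
qed

text \<open>The factor \<open>r\<close> makes the side of the hubs positive for all four lines. As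
  \<open>z\<close> is on line \<open>i3\<close>, the last term vanishes. The nesting gives the lines
  \<open>i0\<close>, \<open>i1\<close>, \<open>i2\<close> the signs - + - or + - + at
  \<open>z\<close>, so the three remaining terms have a common strict sign.\<close>

lemma (in fan) path_not_on_alternating_lines:
  fixes A :: "nat \<Rightarrow> point" and B :: "nat \<Rightarrow> real"
  assumes K4: "x \<in> K" "y \<in> K" "z \<in> K" "t \<in> K" and d: "distinct [x, y, z, t]"
    and e: "{x, y} \<in> E" "{y, z} \<in> E" "{z, t} \<in> E"
    and s: "\<not> side x * side y < 0" "\<not> side y * side z < 0" "\<not> side z * side t < 0"
    and on: "A i0 \<bullet> p x = B i0" "A i2 \<bullet> p y = B i2" "A i3 \<bullet> p z = B i3" "A i1 \<bullet> p t = B i1"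
    and pos: "\<And>i. i \<in> {i0, i1, i2, i3} \<Longrightarrow> 0 \<le> r * (A i \<bullet> p u - B i) \<and> 0 \<le> r * (A i \<bullet> p v - B i) \<and>
      (0 < r * (A i \<bullet> p u - B i) \<or> 0 < r * (A i \<bullet> p v - B i))"
    and alt: "0 < \<alpha>" "0 < \<beta>" "0 < \<gamma>"
      "\<alpha> * (A i0 \<bullet> p z - B i0) - \<beta> * (A i1 \<bullet> p z - B i1) + \<gamma> * (A i2 \<bullet> p z - B i2) - \<delta> * (A i3 \<bullet> p z - B i3) = 0"
  shows False
proof -
  have nz: "side x \<noteq> 0" "side y \<noteq> 0" "side z \<noteq> 0" "side t \<noteq> 0" using side_nonzero K4 by blast+
  have same: "0 < side x * side z" "0 < side y * side z" "0 < side t * side z"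
  proof -
    have "0 < side x * side y" "0 < side y * side z" "0 < side z * side t"
      using s nz by (simp_all add: less_le not_less)
    then show "0 < side x * side z" "0 < side y * side z" "0 < side t * side z"
      by (auto simp: zero_less_mult_iff)
  qed
  have sg: "p k \<in> tri z \<Longrightarrow> r * (A i \<bullet> p z - B i) < 0" "p z \<in> tri k \<Longrightarrow> 0 < r * (A i \<bullet> p z - B i)"
    if "k \<in> K" "k \<noteq> z" "A i \<bullet> p k = B i" "i \<in> {i0, i1, i2, i3}" for k i
    using nested_line_signs[OF that(1) K4(3) that(2), of "r *\<^sub>R A i" "r * B i"] pos[OF that(4)] that(3)
    by (simp_all add: right_diff_distrib)
  let ?g = "\<lambda>i. r * (A i \<bullet> p z - B i)"
  have xyt: "x \<noteq> z" "y \<noteq> z" "t \<noteq> z" using d by auto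
  have "r * (\<alpha> * (A i0 \<bullet> p z - B i0) - \<beta> * (A i1 \<bullet> p z - B i1) + \<gamma> * (A i2 \<bullet> p z - B i2) - \<delta> * (A i3 \<bullet> p z - B i3)) = 0"
    unfolding alt(4) by simp
  then have sum: "\<alpha> * ?g i0 - \<beta> * ?g i1 + \<gamma> * ?g i2 = 0"
    using on(3) by (simp add: algebra_simps)
  from path_nested[OF K4 d e same] show False
  proof (elim disjE conjE)
    assume "p x \<in> tri z" "p y \<in> tri z" "p z \<in> tri t"
    then have "?g i0 < 0" "?g i2 < 0" "0 < ?g i1"
      using sg(1)[OF K4(1) xyt(1) on(1)] sg(1)[OF K4(2) xyt(2) on(2)] sg(2)[OF K4(4) xyt(3) on(4)] by simp_all
    then have "\<alpha> * ?g i0 < 0" "\<gamma> * ?g i2 < 0" "0 < \<beta> * ?g i1"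
      using alt(1-3) by (simp_all only: mult_pos_neg mult_pos_pos)
    then show False using sum by linarith
  next
    assume "p z \<in> tri x" "p z \<in> tri y" "p t \<in> tri z"
    then have "0 < ?g i0" "0 < ?g i2" "?g i1 < 0"
      using sg(2)[OF K4(1) xyt(1) on(1)] sg(2)[OF K4(2) xyt(2) on(2)] sg(1)[OF K4(4) xyt(3) on(4)] by simp_all
    then have "0 < \<alpha> * ?g i0" "0 < \<gamma> * ?g i2" "\<beta> * ?g i1 < 0"
      using alt(1-3) by (simp_all only: mult_pos_neg mult_pos_pos)
    then show False using sum by linarith
  qed
qed

text \<open>There are 13 blocks of 12 lines, 156 in all, and 162 adds the six vertices below 6. Each
  of the three hubs spoils at most 3 blocks and each of the three paths at most 1, so at least one
  of the 13 blocks survives.\<close>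

lemma no_stacked_drawing:
  fixes A :: "nat \<Rightarrow> point" and B :: "nat \<Rightarrow> real"
  assumes n: "162 \<le> n" and cf: "crossing_free {..<n} (stacked_edges n) p"
    and alt: "alternating 156 (\<lambda>i. line_vector (A i) (B i))"
    and ind: "\<And>i j. i < 156 \<Longrightarrow> j < 156 \<Longrightarrow> i \<noteq> j \<Longrightarrow> line_vector (A i) (B i) \<times> line_vector (A j) (B j) \<noteq> 0"
    and on: "\<And>k. 6 \<le> k \<Longrightarrow> k < 162 \<Longrightarrow> A (line_index k) \<bullet> p k = B (line_index k)"
  shows False
proof -
  define G where "G i x = A i \<bullet> x - B i" for i x
  have altG: "\<exists>a b c d. 0 < a \<and> 0 < b \<and> 0 < c \<and> 0 \<le> d \<and> a * G i x - b * G j x + c * G k x - d * G l x = 0"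
    if h: "i < j" "j < k" "k < l" "l < 156" for i j k l x
  proof -
    obtain a b c d where abcd: "0 < a" "0 < b" "0 < c" "0 \<le> d"
      "a *\<^sub>R line_vector (A i) (B i) - b *\<^sub>R line_vector (A j) (B j) + c *\<^sub>R line_vector (A k) (B k)
        - d *\<^sub>R line_vector (A l) (B l) = 0"
      using alt[unfolded alternating_def, rule_format, of i j k l] h by auto
    have "(a *\<^sub>R line_vector (A i) (B i) - b *\<^sub>R line_vector (A j) (B j) + c *\<^sub>R line_vector (A k) (B k)
        - d *\<^sub>R line_vector (A l) (B l)) \<bullet> vector [x$1, x$2, -1] = 0"
      unfolding abcd(5) by simp
    then have "a * G i x - b * G j x + c * G k x - d * G l x = 0"
      by (simp add: inner_diff_left inner_add_left line_vector_inner G_def)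
    then show ?thesis using abcd by blast
  qed
  define bad where "bad h = {b. b < 13 \<and> (\<exists>s<12. sgn (G (12 * b + s) (p h)) \<noteq> sgn (G (12 * b) (p h)))}" for h
  have bad: "card (bad h) \<le> 3" for h
    unfolding bad_def by (rule sign_constant_blocks[of 12 13]) (use altG in simp)
  let ?K = "\<lambda>j. {k. 6 \<le> k \<and> k < n \<and> k mod 3 = j}"
  let ?s = "\<lambda>j k. orient (p j) (p (Suc j mod 3)) (p k)"
  let ?w = "block_vertex"
  have fan: "fan {..<n} (stacked_edges n) p j (Suc j mod 3) (?K j)" if "j < 3" for j
    using fan_stacked[OF cf _ that] n by simp
  have wK: "?w b j q \<in> ?K j" "?w b j q < 162" "6 \<le> ?w b j q" if "j < 3" "b < 13" "q < 4" for b j q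
    using block_vertex_bounds[OF that] n by simp_all
  have edge: "{?w b j q, ?w b j (Suc q)} \<in> stacked_edges n" if "j < 3" "b < 13" "q < 3" for b j q
    using path_edge_stacked[of j b q n] wK(1)[of j b "Suc q"] that by simp
  define split where "split j = {b. b < 13 \<and> (\<exists>q<3. ?s j (?w b j q) * ?s j (?w b j (Suc q)) < 0)}" for j
  have split: "card (split j) \<le> 1" if j: "j < 3" for j
  proof -
    interpret fan "{..<n}" "stacked_edges n" p j "Suc j mod 3" "?K j" by (rule fan[OF j])
    have "b = b'" if b: "b \<in> split j" "b' \<in> split j" for b b'
    proof (rule ccontr)
      assume "b \<noteq> b'"
      obtain q where q: "b < 13" "q < 3" "?s j (?w b j q) * ?s j (?w b j (Suc q)) < 0"
        using b(1) unfolding split_def by blast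
      obtain q' where q': "b' < 13" "q' < 3" "?s j (?w b' j q') * ?s j (?w b' j (Suc q')) < 0"
        using b(2) unfolding split_def by blast
      \<comment> \<open>Distinct blocks share no vertex, so the two crossing edges are disjoint as
        \<open>no_two_split_edges\<close> demands.\<close>
      have ne: "?w b j a \<noteq> ?w b' j a'" if "a < 4" "a' < 4" for a a'
        using \<open>b \<noteq> b'\<close> that unfolding block_vertex_def by presburger
      show False
        using q q' by (intro no_two_split_edges[of "?w b j q" "?w b j (Suc q)" "?w b' j q'" "?w b' j (Suc q')"]
            wK(1) ne edge j) simp_all
    qed
    moreover have "finite (split j)" by (simp add: split_def)
    ultimately show ?thesis by (simp add: card_le_Suc0_iff_eq)
  qed
  have "card ((bad 0 \<union> bad 1 \<union> bad 2) \<union> (split 0 \<union> split 1 \<union> split 2)) \<le> 12"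
    using card_Un_le[of "bad 0 \<union> bad 1 \<union> bad 2" "split 0 \<union> split 1 \<union> split 2"]
      card_Un_le[of "bad 0 \<union> bad 1" "bad 2"] card_Un_le[of "bad 0" "bad 1"]
      card_Un_le[of "split 0 \<union> split 1" "split 2"] card_Un_le[of "split 0" "split 1"]
      bad[of 0] bad[of 1] bad[of 2] split[of 0] split[of 1] split[of 2] by simp
  moreover have "finite ((bad 0 \<union> bad 1 \<union> bad 2) \<union> (split 0 \<union> split 1 \<union> split 2))"
    by (simp add: bad_def split_def)
  ultimately have "\<not> {..<13} \<subseteq> (bad 0 \<union> bad 1 \<union> bad 2) \<union> (split 0 \<union> split 1 \<union> split 2)"
    using card_mono[of "(bad 0 \<union> bad 1 \<union> bad 2) \<union> (split 0 \<union> split 1 \<union> split 2)" "{..<13}"] by auto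
  then obtain b where b: "b < 13" and nbad: "b \<notin> bad 0" "b \<notin> bad 1" "b \<notin> bad 2"
    and nsplit: "b \<notin> split 0" "b \<notin> split 1" "b \<notin> split 2" by blast
  define \<sigma> where "\<sigma> h = sgn (G (12 * b) (p h))" for h
  have less3: "h = 0 \<or> h = 1 \<or> h = 2" if "h < 3" for h :: nat using that by linarith
  have const: "sgn (G (12 * b + s) (p h)) = \<sigma> h" if "h < 3" "s < 12" for h s
  proof -
    have "b \<notin> bad h" using less3[OF that(1)] nbad by (elim disjE) simp_all
    then show ?thesis using b that(2) unfolding bad_def \<sigma>_def by blast
  qed
  have inj: "inj_on p {..<n}" using cf by (simp add: crossing_free_def)
  \<comment> \<open>As signs are constant on the block, two hubs of sign zero would both lie on the
    lines \<open>12 * b\<close> and \<open>12 * b + 1\<close>, which have at most one common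
    point.\<close>
  have "\<not> (\<sigma> j = 0 \<and> \<sigma> k = 0)" if jk: "j < 3" "k < 3" "j \<noteq> k" for j k
  proof
    assume z: "\<sigma> j = 0 \<and> \<sigma> k = 0"
    have "G (12 * b + 0) (p j) = 0" "G (12 * b + 0) (p k) = 0" "G (12 * b + 1) (p j) = 0" "G (12 * b + 1) (p k) = 0"
      using const[OF jk(1), of 0] const[OF jk(2), of 0] const[OF jk(1), of 1] const[OF jk(2), of 1] z
      by (simp_all add: sgn_0_0)
    then have "p j = p k"
      using two_common_points[OF ind[of "12 * b + 0" "12 * b + 1"]] b by (simp add: G_def)
    then show False using inj jk n by (simp add: inj_on_eq_iff)
  qed
  moreover have "\<sigma> h \<in> {-1, 0, 1}" for h by (simp add: \<sigma>_def sgn_if)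
  ultimately obtain j r where j: "j < 3" and r: "r = 1 \<or> r = -1"
    and pos: "0 \<le> r * \<sigma> j" "0 \<le> r * \<sigma> (Suc j mod 3)" "0 < r * \<sigma> j \<or> 0 < r * \<sigma> (Suc j mod 3)"
    using choose_side[of \<sigma>] by blast
  interpret fan "{..<n}" "stacked_edges n" p j "Suc j mod 3" "?K j" by (rule fan[OF j])
  have ns: "\<not> side (?w b j q) * side (?w b j (Suc q)) < 0" if "q < 3" for q
  proof -
    have "b \<notin> split j" using less3[OF j] nsplit by (elim disjE) simp_all
    then show ?thesis using b that unfolding split_def by blast
  qed
  let ?i = "12 * b + 4 * j"
  have "?i + 3 < 12 * b + 12" "12 * b + 12 \<le> 156" using j b by simp_all
  then have i156: "?i + 3 < 156" by linarith
  have Gpos: "0 \<le> r * G i (p h) \<longleftrightarrow> 0 \<le> r * \<sigma> h" "0 < r * G i (p h) \<longleftrightarrow> 0 < r * \<sigma> h"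
    if h: "h < 3" and i: "i \<in> {?i, ?i + 1, ?i + 2, ?i + 3}" for i h
  proof -
    obtain s where s: "s < 12" "i = 12 * b + s"
      using i j by (elim insertE emptyE) (auto intro: that[of "4 * j"] that[of "4 * j + 1"] that[of "4 * j + 2"] that[of "4 * j + 3"])
    show "0 \<le> r * G i (p h) \<longleftrightarrow> 0 \<le> r * \<sigma> h" "0 < r * G i (p h) \<longleftrightarrow> 0 < r * \<sigma> h"
      unfolding s(2) const[OF h s(1), symmetric] using r by (auto simp: sgn_if)
  qed
  \<comment> \<open>The relation is evaluated at \<open>?w b j 2\<close>, which plays the role of
    \<open>z\<close> and lies on the last of the four lines.\<close>
  obtain \<alpha> \<beta> \<gamma> \<delta> where abcd: "0 < \<alpha>" "0 < \<beta>" "0 < \<gamma>"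
    "\<alpha> * G ?i (p (?w b j 2)) - \<beta> * G (?i + 1) (p (?w b j 2)) + \<gamma> * G (?i + 2) (p (?w b j 2)) - \<delta> * G (?i + 3) (p (?w b j 2)) = 0"
    using altG[of ?i "?i + 1" "?i + 2" "?i + 3" "p (?w b j 2)"] i156 by auto
  have onl: "A ?i \<bullet> p (?w b j 0) = B ?i" "A (?i + 2) \<bullet> p (?w b j 1) = B (?i + 2)"
    "A (?i + 3) \<bullet> p (?w b j 2) = B (?i + 3)" "A (?i + 1) \<bullet> p (?w b j 3) = B (?i + 1)"
    using on[of "?w b j 0"] on[of "?w b j 1"] on[of "?w b j 2"] on[of "?w b j 3"]
      wK(2,3)[OF j b] unfolding line_index_block[OF j] by simp_all
  have Suc: "Suc 0 = 1" "Suc 1 = 2" "Suc 2 = 3" by simp_all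
  have hubs: "j < 3" "Suc j mod 3 < 3" using j by simp_all
  show False
  proof (rule path_not_on_alternating_lines[of "?w b j 0" "?w b j 1" "?w b j 2" "?w b j 3" A ?i B "?i + 2" "?i + 3" "?i + 1" r])
    show "?w b j 0 \<in> ?K j" "?w b j 1 \<in> ?K j" "?w b j 2 \<in> ?K j" "?w b j 3 \<in> ?K j"
      by (rule wK(1)[OF j b]; simp)+
    show "distinct [?w b j 0, ?w b j 1, ?w b j 2, ?w b j 3]" by (simp add: block_vertex_def)
    show "{?w b j 0, ?w b j 1} \<in> stacked_edges n" "{?w b j 1, ?w b j 2} \<in> stacked_edges n"
      "{?w b j 2, ?w b j 3} \<in> stacked_edges n"
      using edge[OF j b, of 0] edge[OF j b, of 1] edge[OF j b, of 2] unfolding Suc by simp_all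
    show "\<not> side (?w b j 0) * side (?w b j 1) < 0" "\<not> side (?w b j 1) * side (?w b j 2) < 0"
      "\<not> side (?w b j 2) * side (?w b j 3) < 0"
      using ns[of 0] ns[of 1] ns[of 2] unfolding Suc by simp_all
    show "0 \<le> r * (A i \<bullet> p j - B i) \<and> 0 \<le> r * (A i \<bullet> p (Suc j mod 3) - B i) \<and>
      (0 < r * (A i \<bullet> p j - B i) \<or> 0 < r * (A i \<bullet> p (Suc j mod 3) - B i))"
      if "i \<in> {?i, ?i + 1, ?i + 2, ?i + 3}" for i
      using Gpos[OF hubs(1) that] Gpos[OF hubs(2) that] pos unfolding G_def by blast
  qed (use onl abcd in \<open>simp_all only: G_def\<close>)
qed

text \<open>Serves to complete the labelling, which is prescribed only on the vertices of the
  blocks.\<close>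

lemma extend_injection_to_bijection:
  fixes g :: "'a \<Rightarrow> 'b"
  assumes "finite V" "finite W" "card V = card W" "C \<subseteq> V" "inj_on g C" "g ` C \<subseteq> W"
  shows "\<exists>h. bij_betw h V W \<and> (\<forall>v\<in>C. h v = g v)"
proof -
  have "card (V - C) = card (W - g ` C)"
    using assms by (simp add: card_Diff_subset card_image finite_subset)
  then obtain k where k: "bij_betw k (V - C) (W - g ` C)"
    using finite_same_card_bij[of "V - C" "W - g ` C"] assms(1,2) by blast
  let ?h = "\<lambda>v. if v \<in> C then g v else k v"
  have "bij_betw ?h C (g ` C)"
    using assms(5) by (simp add: bij_betw_def inj_on_def image_def)
  moreover have "bij_betw ?h (V - C) (W - g ` C)"
    using k by (rule bij_betw_cong[THEN iffD1, rotated]) simp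
  ultimately have "bij_betw ?h (C \<union> (V - C)) (g ` C \<union> (W - g ` C))"
    by (rule bij_betw_combine) blast
  moreover have "C \<union> (V - C) = V" "g ` C \<union> (W - g ` C) = W" using assms by auto
  ultimately show ?thesis by (intro exI[of _ ?h]) simp
qed

theorem mainTheorem13:
  shows "\<exists>c'::nat. \<forall>n\<ge>c'. \<forall>L. labelled_lines n L \<longrightarrow>
           \<not> (\<forall>V E. simple_graph V E \<and> card V = n \<and> planar V E \<longrightarrow> supports L V E)"
proof -
  obtain R where R: "\<forall>n\<ge>R. \<forall>P :: nat \<Rightarrow> real^3. (\<forall>i<n. \<forall>j<n. i \<noteq> j \<longrightarrow> P i \<times> P j \<noteq> 0) \<longrightarrow>
     (\<exists>f. strict_mono_on {..<156} f \<and> f ` {..<156} \<subseteq> {..<n} \<and> alternating 156 (\<lambda>i. P (f i)))"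
    using ramsey_alternating[of 156] by (elim exE)
  show ?thesis
  \<comment> \<open>\<open>R\<close> yields 156 alternating lines, and 162 leaves room for the 13
    blocks of vertices.\<close>
  proof (intro exI[of _ "max R 162"] allI impI notI)
    fix n and L :: "nat \<Rightarrow> point set"
    assume n: "max R 162 \<le> n" and L: "labelled_lines n L"
      and sup: "\<forall>V E. simple_graph V E \<and> card V = n \<and> planar V E \<longrightarrow> supports L V E"
    have Linj: "inj_on L {1..n}" using L by (simp add: labelled_lines_def)
    have "\<forall>i. \<exists>a b. i \<in> {1..n} \<longrightarrow> a \<noteq> 0 \<and> L i = {x. a \<bullet> x = b}"
      using L unfolding labelled_lines_def is_line_def by meson
    then obtain a b where ab: "\<And>i. i \<in> {1..n} \<Longrightarrow> a i \<noteq> 0 \<and> L i = {x. a i \<bullet> x = b i}"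
      by metis
    \<comment> \<open>The Ramsey argument counts from 0 and the labels from 1, hence the
      \<open>Suc\<close> here and in the labelling.\<close>
    define P where "P i = line_vector (a (Suc i)) (b (Suc i))" for i
    have cross: "P i \<times> P j \<noteq> 0" if "i < n" "j < n" "i \<noteq> j" for i j
    proof -
      have "Suc i \<in> {1..n}" "Suc j \<in> {1..n}" using that by simp_all
      moreover from this have "L (Suc i) \<noteq> L (Suc j)" using Linj that(3) by (simp add: inj_on_eq_iff)
      ultimately show ?thesis
        unfolding P_def using cross_line_vector_nonzero[of "a (Suc i)" "a (Suc j)" "b (Suc i)" "b (Suc j)"] ab by simp
    qed
    have "R \<le> n" using n by simp
    then obtain f where f: "strict_mono_on {..<156} f" "f ` {..<156} \<subseteq> {..<n}" "alternating 156 (\<lambda>i. P (f i))"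
      using R[rule_format, of n P] cross by auto
    have finj: "inj_on f {..<156}" using f(1) by (rule strict_mono_on_imp_inj_on)
    have fless: "f i < n" if "i < 156" for i using f(2) that by blast
    let ?C = "{6..<162::nat}"
    have idx: "line_index k < 156" if "k \<in> ?C" for k
      using line_index_less[of k 13] that by simp
    have ginj: "inj_on (\<lambda>k. Suc (f (line_index k))) ?C"
    proof (rule inj_onI)
      fix k l assume kl: "k \<in> ?C" "l \<in> ?C" "Suc (f (line_index k)) = Suc (f (line_index l))"
      then have "line_index k = line_index l" using inj_onD[OF finj] idx by simp
      then show "k = l" using inj_onD[OF line_index_inj] kl by simp
    qed
    have gim: "(\<lambda>k. Suc (f (line_index k))) ` ?C \<subseteq> {1..n}"
      using fless idx by (simp add: image_subset_iff Suc_le_eq)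
    \<comment> \<open>The labelling that cannot be realised: a block vertex \<open>k\<close> gets
      the label of member \<open>line_index k\<close> of the alternating sequence.\<close>
    obtain \<pi> where \<pi>: "bij_betw \<pi> {..<n} {1..n}" "\<forall>k\<in>?C. \<pi> k = Suc (f (line_index k))"
    proof -
      have "?C \<subseteq> {..<n}" using n by auto
      then show ?thesis
        using extend_injection_to_bijection[OF _ _ _ _ ginj gim, of "{..<n}"] that by auto
    qed
    have n4: "3 \<le> n" "4 \<le> n" using n by simp_all
    have "supports L {..<n} (stacked_edges n)"
      using sup simple_graph_stacked[OF n4(1)] planar_stacked[OF n4(2)] by simp
    then have "supports_with L {..<n} (stacked_edges n) \<pi>"
      using \<pi>(1) by (simp add: supports_def)
    then obtain p where "straight_drawing {..<n} (stacked_edges n) p" and pL: "\<forall>v\<in>{..<n}. p v \<in> L (\<pi> v)"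
      unfolding supports_with_def by (elim exE conjE)
    then have cf: "crossing_free {..<n} (stacked_edges n) p"
      using straight_drawing_iff_crossing_free[OF simple_graph_stacked[OF n4(1)]] by simp
    show False
    proof (rule no_stacked_drawing[OF _ cf, of "\<lambda>i. a (Suc (f i))" "\<lambda>i. b (Suc (f i))"])
      show "162 \<le> n" using n by simp
      show "alternating 156 (\<lambda>i. line_vector (a (Suc (f i))) (b (Suc (f i))))"
        using f(3) by (simp add: P_def)
      show "line_vector (a (Suc (f i))) (b (Suc (f i))) \<times> line_vector (a (Suc (f j))) (b (Suc (f j))) \<noteq> 0"
        if "i < 156" "j < 156" "i \<noteq> j" for i j
        using cross[OF fless[OF that(1)] fless[OF that(2)]] that inj_onD[OF finj, of i j]
        unfolding P_def by auto
      show "a (Suc (f (line_index k))) \<bullet> p k = b (Suc (f (line_index k)))" if "6 \<le> k" "k < 162" for k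
      proof -
        have "k \<in> ?C" "k \<in> {..<n}" using that n by simp_all
        then have "p k \<in> L (Suc (f (line_index k)))" "Suc (f (line_index k)) \<in> {1..n}"
          using bspec[OF pL, of k] bspec[OF \<pi>(2), of k] fless[OF idx[of k]] by simp_all
        then show ?thesis using ab by auto
      qed
    qed
  qed
qed

end
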